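(* An element of Thompson's group $T$ is torsion if and only if it is a conjugate (in $T$) of $c_i^j$ for some integers $i\ge0$ and $j$.
   Context: Thompson's group $T$ is the group of orientation-preserving piecewise-linear homeomorphisms of $S^1=[0,1]/(0\sim 1)$ with finitely many breakpoints, all slopes powers of $2$, and dyadic breakpoints, mapping dyadic rationals to dyadic rationals. For $n\ge 0$ let $I_k=[1-2^{-k},1-2^{-k-1}]$ for $0\le k\le n$ and $I_{n+1}=[1-2^{-n-1},1]$. The element $c_n\in T$ maps $I_0$ affinely onto $I_{n+1}$ and $I_k$ affinely onto $I_{k-1}$ for $1\le k\le n+1$; it has order $n+2$. *)

theory Defs
  imports "HOL-Analysis.Analysis" "HOL-Algebra.Bij" "HOL-Algebra.Multiplicative_Group"
begin

section \<open>The circle\<close>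

text \<open>The points of [0,1]/(0~1) are represented by the fundamental domain [0,1); the quotient
  projection from [0,1] is then \<^const>\<open>frac\<close>, which sends 1 to 0.\<close>

abbreviation S1 :: "real set" where "S1 \<equiv> {0..<1}"

definition circle :: "real topology" where
  "circle = topology (\<lambda>U. U \<subseteq> S1 \<and> openin (top_of_set {0..1}) {x \<in> {0..1}. frac x \<in> U})"

lemma openin_circle:
  "openin circle U \<longleftrightarrow> U \<subseteq> S1 \<and> openin (top_of_set {0..1}) {x \<in> {0..1}. frac x \<in> U}"
proof -
  let ?P = "\<lambda>U. U \<subseteq> S1 \<and> openin (top_of_set {0..1}) {x \<in> {0..1::real}. frac x \<in> U}"
  have "istopology ?P"
    unfolding istopology_def
  proof (intro conjI allI impI)
    fix U V :: "real set" assume "?P U" "?P V"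
    moreover have "{x \<in> {0..1}. frac x \<in> U \<inter> V} = {x \<in> {0..1}. frac x \<in> U} \<inter> {x \<in> {0..1}. frac x \<in> V}"
      by auto
    ultimately show "U \<inter> V \<subseteq> S1" "openin (top_of_set {0..1}) {x \<in> {0..1}. frac x \<in> U \<inter> V}"
      by (auto intro: openin_Int)
  next
    fix \<K> :: "real set set" assume K: "\<forall>K\<in>\<K>. ?P K"
    have "{x \<in> {0..1}. frac x \<in> \<Union>\<K>} = (\<Union>K\<in>\<K>. {x \<in> {0..1}. frac x \<in> K})" by auto
    then show "\<Union>\<K> \<subseteq> S1" "openin (top_of_set {0..1}) {x \<in> {0..1}. frac x \<in> \<Union>\<K>}"
      using K by (auto intro!: openin_Union)
  qed
  then show ?thesis by (simp add: circle_def topology_inverse')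
qed

lemma frac_image_unit: "frac ` {0..1::real} = S1"
proof
  show "frac ` {0..1::real} \<subseteq> S1" by (auto simp: frac_lt_1)
  show "S1 \<subseteq> frac ` {0..1::real}"
  proof
    fix x :: real assume "x \<in> S1"
    then have "frac x = x" "x \<in> {0..1}" by (auto simp: frac_eq)
    then show "x \<in> frac ` {0..1::real}" by (metis imageI)
  qed
qed

lemma topspace_circle [simp]: "topspace circle = S1"
proof -
  have "{x \<in> {0..1}. frac x \<in> S1} = {0..1::real}" by (auto simp: frac_lt_1)
  then have "openin circle S1" by (simp add: openin_circle)
  then show ?thesis
    by (metis openin_circle openin_subset openin_topspace subset_antisym)
qed

lemma quotient_map_circle: "quotient_map (top_of_set {0..1}) circle frac"
  unfolding quotient_map_def using frac_image_unit
  by (auto simp: openin_circle)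


section \<open>Thompson's group T\<close>

text \<open>A lift of a circle map along the universal cover \<^term>\<open>frac\<close> of the circle by the real line.
  A homeomorphism preserves orientation if it has an increasing lift; its slopes and breakpoints are
  those of a lift.\<close>

definition is_lift :: "(real \<Rightarrow> real) \<Rightarrow> (real \<Rightarrow> real) \<Rightarrow> bool" where
  "is_lift F f \<longleftrightarrow> continuous_on UNIV F \<and> (\<forall>x. frac (F x) = f (frac x))"

text \<open>The set \<open>B\<close> consists of the breakpoints on the circle, so the breakpoints of the lift are the
  reals with fractional part in \<open>B\<close>. The library's \<^const>\<open>dyadics\<close> are the nonnegative
  dyadic rationals.\<close>

definition dyadic_PL :: "(real \<Rightarrow> real) \<Rightarrow> bool" where
  "dyadic_PL F \<longleftrightarrow> (\<exists>B. finite B \<and> B \<subseteq> S1 \<inter> dyadics \<and>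
     (\<forall>a b. a < b \<and> (\<forall>x\<in>{a<..<b}. frac x \<notin> B) \<longrightarrow>
        (\<exists>(k::int) c. \<forall>x\<in>{a..b}. F x = 2 powi k * x + c)))"

definition thompson_T_maps :: "(real \<Rightarrow> real) set" where
  "thompson_T_maps = {f \<in> Bij S1.
     homeomorphic_map circle circle f \<and>
     (\<exists>F. is_lift F f \<and> strict_mono F \<and> dyadic_PL F) \<and>
     f ` (S1 \<inter> dyadics) \<subseteq> dyadics}"

definition thompson_T :: "(real \<Rightarrow> real) monoid" where
  "thompson_T = BijGroup S1 \<lparr>carrier := thompson_T_maps\<rparr>"


section \<open>The elements c_n\<close>

text \<open>\<open>I_k = [I_left n k, I_left n (k + 1)]\<close> for \<open>k \<le> n + 1\<close>.\<close>

definition I_left :: "nat \<Rightarrow> nat \<Rightarrow> real" where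
  "I_left n k = (if k \<le> n + 1 then 1 - 1 / 2 ^ k else 1)"

definition affine_onto :: "real \<Rightarrow> real \<Rightarrow> real \<Rightarrow> real \<Rightarrow> real \<Rightarrow> real" where
  "affine_onto a b a' b' x = a' + (x - a) * (b' - a') / (b - a)"

definition thompson_c :: "nat \<Rightarrow> real \<Rightarrow> real" where
  "thompson_c n = (\<lambda>x\<in>S1.
     let k = (THE k. k \<le> n + 1 \<and> x \<in> {I_left n k..<I_left n (k + 1)});
         k' = (if k = 0 then n + 1 else k - 1)
     in affine_onto (I_left n k) (I_left n (k + 1)) (I_left n k') (I_left n (k' + 1)) x)"


section \<open>Torsion\<close>

definition torsion_element :: "('a, 'b) monoid_scheme \<Rightarrow> 'a \<Rightarrow> bool" where
  "torsion_element G g \<longleftrightarrow> g \<in> carrier G \<and> (\<exists>m::nat. m > 0 \<and> g [^]\<^bsub>G\<^esub> m = \<one>\<^bsub>G\<^esub>)"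

definition conjugate_in :: "('a, 'b) monoid_scheme \<Rightarrow> 'a \<Rightarrow> 'a \<Rightarrow> bool" where
  "conjugate_in G g g' \<longleftrightarrow> (\<exists>h\<in>carrier G. g = h \<otimes>\<^bsub>G\<^esub> g' \<otimes>\<^bsub>G\<^esub> inv\<^bsub>G\<^esub> h)"


section \<open>T is a group containing the c_n\<close>

text \<open>In particular inverses and integer powers in \<^const>\<open>thompson_T\<close> have their usual meaning.\<close>

lemma frac_S1: "frac x \<in> S1" by (auto simp: frac_lt_1)
lemma frac_id: "x \<in> S1 \<Longrightarrow> frac x = x" by (auto simp: frac_eq)

lemma thompson_T_mapsE:
  assumes "f \<in> thompson_T_maps"
  obtains F where "f \<in> Bij S1" "homeomorphic_map circle circle f" "is_lift F f" "strict_mono F" "dyadic_PL F"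
     "f ` (S1 \<inter> dyadics) \<subseteq> dyadics"
  using assms by (auto simp: thompson_T_maps_def)

definition signed_dyadics :: "real set" where "signed_dyadics = {x. \<exists>(m::int) (k::nat). x = of_int m / 2^k}"

lemma Dy_add: assumes "x \<in> signed_dyadics" "y \<in> signed_dyadics" shows "x + y \<in> signed_dyadics"
proof -
  from assms obtain m k n l where x: "x = of_int m / 2^k" and y: "y = of_int n / 2^l" by (auto simp: signed_dyadics_def)
  have "x + y = of_int (m * 2^l + n * 2^k) / 2^(k+l)" by (simp add: x y power_add field_simps)
  then show ?thesis unfolding signed_dyadics_def by blast
qed

lemma Dy_uminus: assumes "x \<in> signed_dyadics" shows "- x \<in> signed_dyadics"
proof -
  from assms obtain m k where x: "x = of_int m / 2^k" by (auto simp: signed_dyadics_def)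
  have "- x = of_int (- m) / 2^k" by (simp add: x)
  then show ?thesis unfolding signed_dyadics_def by blast
qed

lemma Dy_diff: "x \<in> signed_dyadics \<Longrightarrow> y \<in> signed_dyadics \<Longrightarrow> x - y \<in> signed_dyadics"
  using Dy_add[of x "-y"] Dy_uminus[of y] by simp

lemma Dy_int: "of_int m \<in> signed_dyadics" unfolding signed_dyadics_def by (auto intro!: exI[of _ m] exI[of _ "0::nat"])

lemma Dy_mult: assumes "x \<in> signed_dyadics" "y \<in> signed_dyadics" shows "x * y \<in> signed_dyadics"
proof -
  from assms obtain m k n l where x: "x = of_int m / 2^k" and y: "y = of_int n / 2^l" by (auto simp: signed_dyadics_def)
  have "x * y = of_int (m * n) / 2^(k+l)" by (simp add: x y power_add)
  then show ?thesis unfolding signed_dyadics_def by blast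
qed

lemma Dy_pow: "2 powi k \<in> signed_dyadics"
proof (cases "k \<ge> 0")
  case True
  then have "(2::real) powi k = of_int (2 ^ nat k) / 2 ^ 0" by (simp add: power_int_def)
  then show ?thesis unfolding signed_dyadics_def by blast
next
  case False
  then have "(2::real) powi k = of_int 1 / 2 ^ (nat (-k))" by (simp add: power_int_def field_simps)
  then show ?thesis unfolding signed_dyadics_def by blast
qed

lemma Dy_frac_iff: "frac x \<in> signed_dyadics \<longleftrightarrow> x \<in> signed_dyadics"
  unfolding frac_def using Dy_diff[of x "of_int \<lfloor>x\<rfloor>"] Dy_add[of "x - of_int \<lfloor>x\<rfloor>" "of_int \<lfloor>x\<rfloor>"] Dy_int by auto

lemma dyadics_iff_signed: "x \<in> dyadics \<longleftrightarrow> x \<in> signed_dyadics \<and> (0::real) \<le> x"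
proof
  assume "x \<in> dyadics"
  then obtain m k where x: "x = of_nat m / 2^k" by (auto simp: dyadics_def)
  then have "x = of_int (int m) / 2^k" by simp
  then show "x \<in> signed_dyadics \<and> 0 \<le> x" unfolding signed_dyadics_def x by fastforce
next
  assume a: "x \<in> signed_dyadics \<and> 0 \<le> x"
  then obtain m k where x: "x = of_int m / 2^k" by (auto simp: signed_dyadics_def)
  have "m \<ge> 0" using a by (simp add: x zero_le_divide_iff not_le) (metis not_le zero_less_numeral zero_less_power)
  then have "x = of_nat (nat m) / 2^k" by (simp add: x)
  then show "x \<in> dyadics" unfolding dyadics_def by blast
qed

lemma lift_continuous_frac: "continuous_map euclideanreal circle frac"
  unfolding continuous_map_def
proof (intro conjI allI impI)
  show "frac \<in> topspace euclideanreal \<rightarrow> topspace circle" by (auto simp: frac_lt_1)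
next
  fix U assume U: "openin circle U"
  define K where "K = {x\<in>{0..1::real}. frac x \<notin> U}"
  have "K = {0..1} - {x\<in>{0..1}. frac x \<in> U}" by (auto simp: K_def)
  then have "closedin (top_of_set {0..1}) K"
    using U by (simp add: openin_circle closedin_def Diff_Diff_Int) (metis (no_types, lifting) inf.absorb2 openin_imp_subset)
  then have "compact K"
    using closedin_compact compact_Icc by blast
  then have "closed (\<Union>x\<in>K. \<Union>y\<in>(\<int>::real set). {x+y})"
    by (rule compact_closed_sums) (rule closed_Ints)
  moreover have "(\<Union>x\<in>K. \<Union>y\<in>(\<int>::real set). {x+y}) = - {x. frac x \<in> U}"
  proof (intro Set.set_eqI iffI)
    fix z assume "z \<in> (\<Union>x\<in>K. \<Union>y\<in>(\<int>::real set). {x+y})"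
    then obtain x y where "x \<in> K" "y \<in> \<int>" "z = x + y" by auto
    then show "z \<in> - {x. frac x \<in> U}"
      by (auto simp: K_def Ints_def)
  next
    fix z assume "z \<in> - {x. frac x \<in> U}"
    then have "frac z \<in> K" by (auto simp: K_def frac_lt_1 less_imp_le)
    moreover have "z = frac z + of_int \<lfloor>z\<rfloor>" by (simp add: frac_def)
    ultimately show "z \<in> (\<Union>x\<in>K. \<Union>y\<in>(\<int>::real set). {x+y})" by (metis Ints_of_int UN_iff singletonI)
  qed
  ultimately have "open {x. frac x \<in> U}" by (simp add: open_closed)
  then show "openin euclideanreal {x \<in> topspace euclideanreal. frac x \<in> U}" by simp
qed

lemma is_lift_continuous_map:
  assumes "is_lift F f"
  shows "continuous_map circle circle f"
proof -
  have "continuous_map (top_of_set {0..1}) euclideanreal F"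
    using assms by (auto simp: is_lift_def intro: continuous_on_subset)
  then have "continuous_map (top_of_set {0..1}) circle (frac \<circ> F)"
    using continuous_map_compose lift_continuous_frac by blast
  moreover have "frac \<circ> F = f \<circ> frac" using assms by (auto simp: is_lift_def)
  ultimately show ?thesis
    using continuous_compose_quotient_map[OF quotient_map_circle] by metis
qed

lemma lift_periodic:
  assumes f: "inj_on f S1" and F: "is_lift F f" and m: "strict_mono F"
  shows "F (x + of_int n) = F x + of_int n"
proof -
  have 1: "F (x + 1) = F x + 1" for x
  proof -
    have "frac (F (x+1)) = frac (F x)" using F by (simp add: is_lift_def frac_1_eq)
    then have "F (x+1) - F x = of_int (\<lfloor>F (x+1)\<rfloor> - \<lfloor>F x\<rfloor>)" by (simp add: frac_def)
    then obtain d :: int where d: "F (x+1) - F x = of_int d" by blast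
    have "F (x+1) > F x" using m by (simp add: strict_mono_def)
    then have "d > 0" using d by linarith
    moreover have "\<not> d \<ge> 2"
    proof
      assume "d \<ge> 2"
      then have "F x \<le> F x + 1" "F x + 1 \<le> F (x + 1)" using d by linarith+
      then obtain z where z: "x \<le> z" "z \<le> x + 1" "F z = F x + 1"
        using IVT'[of F x "F x + 1" "x+1"] F by (auto simp: is_lift_def intro: continuous_on_subset)
      have "f (frac z) = f (frac x)" using F z by (metis frac_1_eq is_lift_def)
      then have "frac z = frac x" using f frac_S1 by (meson inj_onD)
      moreover have "z \<noteq> x" using z by auto
      moreover have "z \<noteq> x + 1" using z d \<open>d \<ge> 2\<close> by auto
      ultimately have "z - x = of_int (\<lfloor>z\<rfloor> - \<lfloor>x\<rfloor>)" "0 < z - x" "z - x < 1" using z by (auto simp: frac_def)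
      then have "0 < \<lfloor>z\<rfloor> - \<lfloor>x\<rfloor>" "\<lfloor>z\<rfloor> - \<lfloor>x\<rfloor> < 1" by (metis of_int_0_less_iff, metis of_int_less_1_iff)
      then show False by linarith
    qed
    ultimately show ?thesis using d by auto
  qed
  have nat: "F (x + of_nat k) = F x + of_nat k" for x k
  proof (induction k)
    case (Suc k)
    then show ?case using 1[of "x + of_nat k"] by (simp add: algebra_simps)
  qed simp
  show ?thesis
  proof (cases "n \<ge> 0")
    case True
    then show ?thesis using nat[of x "nat n"] by simp
  next
    case False
    then show ?thesis using nat[of "x + of_int n" "nat (-n)"] by simp
  qed
qed

lemma lift_surj:
  assumes f: "f \<in> Bij S1" and F: "is_lift F f" and m: "strict_mono F"
  shows "surj F"
proof -
  have "\<exists>x. F x = y" for y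
  proof -
    from f obtain x where x: "x \<in> S1" "f x = frac y"
      using frac_S1 by (metis Bij_def IntE bij_betw_iff_bijections mem_Collect_eq)
    then have "frac (F x) = frac y" using F by (metis frac_id is_lift_def)
    then have "y = F x + of_int (\<lfloor>y\<rfloor> - \<lfloor>F x\<rfloor>)" by (simp add: frac_def)
    then show ?thesis using lift_periodic[OF _ F m] f
      by (metis (no_types, lifting) Bij_def IntE bij_betw_def mem_Collect_eq)
  qed
  then show ?thesis by (metis surjI)
qed

lemma dyadic_preimage:
  assumes f: "f \<in> Bij S1" and F: "is_lift F f" and PL: "dyadic_PL F" and D: "f ` (S1 \<inter> dyadics) \<subseteq> dyadics"
    and x: "x \<in> S1" and fx: "f x \<in> dyadics"
  shows "x \<in> dyadics"
proof -
  obtain B where B: "finite B" "B \<subseteq> S1 \<inter> dyadics" 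
    "\<And>a b. a < b \<Longrightarrow> (\<forall>x\<in>{a<..<b}. frac x \<notin> B) \<Longrightarrow>
        (\<exists>(k::int) c. \<forall>x\<in>{a..b}. F x = 2 powi k * x + c)"
    using PL unfolding dyadic_PL_def by metis
  define A where "A = insert 0 B \<inter> {0..x}"
  have A: "finite A" "0 \<in> A" using B x by (auto simp: A_def)
  define a where "a = Max A"
  have aA: "a \<in> A" unfolding a_def using A by (intro Max_in) auto
  have amax: "b \<le> a" if "b \<in> A" for b unfolding a_def using A that by simp
  have aD: "a \<in> signed_dyadics" using aA B(2) Dy_int[of 0] by (auto simp: A_def dyadics_iff_signed)
  show ?thesis
  proof (cases "a = x")
    case True
    then show ?thesis using aD x by (auto simp: dyadics_iff_signed)
  next
    case False
    then have ax: "0 \<le> a" "a < x" using aA by (auto simp: A_def)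
    have "\<forall>z\<in>{a<..<x}. frac z \<notin> B"
    proof
      fix z assume z: "z \<in> {a<..<x}"
      then have "z \<in> S1" using ax x by auto
      then have "frac z = z" by (rule frac_id)
      then show "frac z \<notin> B" using amax[of z] z ax by (auto simp: A_def)
    qed
    then obtain k c where kc: "\<And>z. z\<in>{a..x} \<Longrightarrow> F z = 2 powi k * z + c"
      using B(3)[of a x] ax by auto
    have *: "F z \<in> signed_dyadics" if "z \<in> S1" "f z \<in> signed_dyadics" for z
      using that F by (metis Dy_frac_iff frac_id is_lift_def)
    have "f a \<in> dyadics" using D aD ax x by (auto simp: dyadics_iff_signed image_subset_iff)
    then have "F a \<in> signed_dyadics" using * ax x by (auto simp: dyadics_iff_signed)
    moreover have "F x \<in> signed_dyadics" using * fx x by (auto simp: dyadics_iff_signed)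
    moreover have "F x - F a = 2 powi k * (x - a)" using kc[of a] kc[of x] ax by (simp add: algebra_simps)
    then have "x = a + 2 powi (-k) * (F x - F a)" by (simp add: power_int_minus field_simps)
    ultimately have "x \<in> signed_dyadics" using aD Dy_pow Dy_diff Dy_add Dy_mult by metis
    then show ?thesis using x by (auto simp: dyadics_iff_signed)
  qed
qed

lemma T_compose:
  assumes f: "f \<in> thompson_T_maps" and g: "g \<in> thompson_T_maps"
  shows "compose S1 g f \<in> thompson_T_maps"
proof -
  obtain F where F: "f \<in> Bij S1" "homeomorphic_map circle circle f" "is_lift F f" "strict_mono F" "dyadic_PL F"
     "f ` (S1 \<inter> dyadics) \<subseteq> dyadics" using f by (rule thompson_T_mapsE)
  obtain G where G: "g \<in> Bij S1" "homeomorphic_map circle circle g" "is_lift G g" "strict_mono G" "dyadic_PL G"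
     "g ` (S1 \<inter> dyadics) \<subseteq> dyadics" using g by (rule thompson_T_mapsE)
  have fS: "f x \<in> S1" if "x \<in> S1" for x using F(1) that Bij_imp_funcset by blast
  have 1: "compose S1 g f \<in> Bij S1" using F G by (simp add: compose_Bij)
  have 2: "homeomorphic_map circle circle (compose S1 g f)"
    using homeomorphic_map_compose[OF F(2) G(2)]
    by (rule homeomorphic_map_eq) (simp add: compose_def)
  have 3: "is_lift (G \<circ> F) (compose S1 g f)"
    using F(3) G(3) frac_S1 unfolding is_lift_def
    by (auto simp: compose_def intro: continuous_on_compose2)
  have 4: "strict_mono (G \<circ> F)" using F(4) G(4) by (simp add: strict_mono_def)
  obtain B where B: "finite B" "B \<subseteq> S1 \<inter> dyadics" 
    "\<And>a b. a < b \<Longrightarrow> (\<forall>x\<in>{a<..<b}. frac x \<notin> B) \<Longrightarrow>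
        (\<exists>(k::int) c. \<forall>x\<in>{a..b}. F x = 2 powi k * x + c)"
    using F(5) unfolding dyadic_PL_def by metis
  obtain C where C: "finite C" "C \<subseteq> S1 \<inter> dyadics" 
    "\<And>a b. a < b \<Longrightarrow> (\<forall>x\<in>{a<..<b}. frac x \<notin> C) \<Longrightarrow>
        (\<exists>(k::int) c. \<forall>x\<in>{a..b}. G x = 2 powi k * x + c)"
    using G(5) unfolding dyadic_PL_def by metis
  define A where "A = B \<union> {x\<in>S1. f x \<in> C}"
  have "inj_on f S1" using F(1) by (auto simp: Bij_def bij_betw_def)
  then have "finite (f -` C \<inter> S1)" using C(1) by (rule finite_vimage_IntI[rotated])
  moreover have "{x\<in>S1. f x \<in> C} = f -` C \<inter> S1" by auto
  ultimately have "finite A" using B by (simp add: A_def)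
  moreover have "A \<subseteq> S1 \<inter> dyadics"
    using B C dyadic_preimage[OF F(1,3,5,6)] by (auto simp: A_def)
  moreover have "\<exists>(k::int) c. \<forall>x\<in>{a..b}. (G\<circ>F) x = 2 powi k * x + c"
    if ab: "a < b" and no: "\<forall>x\<in>{a<..<b}. frac x \<notin> A" for a b
  proof -
    obtain k c where kc: "\<And>x. x\<in>{a..b} \<Longrightarrow> F x = 2 powi k * x + c"
      using B(3)[of a b] ab no by (auto simp: A_def)
    have "F a < F b" using F(4) ab by (simp add: strict_mono_def)
    moreover have "\<forall>y\<in>{F a<..<F b}. frac y \<notin> C"
    proof
      fix y assume y: "y \<in> {F a<..<F b}"
      obtain x where x: "F x = y" using lift_surj[OF F(1,3,4)] by (metis surjD)
      with y have "x \<in> {a<..<b}" using F(4) by (auto simp: strict_mono_less)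
      then have "f (frac x) \<notin> C" using no frac_S1[of x] by (auto simp: A_def)
      then show "frac y \<notin> C" using F(3) x by (auto simp: is_lift_def)
    qed
    ultimately obtain l d where ld: "\<And>x. x\<in>{F a..F b} \<Longrightarrow> G x = 2 powi l * x + d"
      using C(3)[of "F a" "F b"] by blast
    have "\<forall>x\<in>{a..b}. (G\<circ>F) x = 2 powi (l+k) * x + (2 powi l * c + d)"
    proof
      fix x assume x: "x \<in> {a..b}"
      then have "F x \<in> {F a..F b}" using F(4) by (auto simp: strict_mono_less_eq)
      then show "(G\<circ>F) x = 2 powi (l+k) * x + (2 powi l * c + d)"
        using ld kc[OF x] by (simp add: power_int_add algebra_simps)
    qed
    then show ?thesis by blast
  qed
  ultimately have 5: "dyadic_PL (G \<circ> F)" unfolding dyadic_PL_def by (intro exI[of _ A]) auto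
  have 6: "compose S1 g f ` (S1 \<inter> dyadics) \<subseteq> dyadics"
    proof
    fix y assume "y \<in> compose S1 g f ` (S1 \<inter> dyadics)"
    then obtain x where x: "x \<in> S1" "x \<in> dyadics" "y = g (f x)" by (auto simp: compose_def)
    then have "f x \<in> S1 \<inter> dyadics" using F(6) fS by blast
    then show "y \<in> dyadics" using G(6) x by blast
  qed
  show ?thesis using 1 2 3 4 5 6 unfolding thompson_T_maps_def by blast
qed

lemma T_inverse:
  assumes f: "f \<in> thompson_T_maps"
  shows "(\<lambda>x\<in>S1. inv_into S1 f x) \<in> thompson_T_maps"
proof -
  obtain F where F: "f \<in> Bij S1" "homeomorphic_map circle circle f" "is_lift F f" "strict_mono F" "dyadic_PL F"
     "f ` (S1 \<inter> dyadics) \<subseteq> dyadics" using f by (rule thompson_T_mapsE)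
  define g where "g = (\<lambda>x\<in>S1. inv_into S1 f x)"
  define G where "G = inv_into UNIV F"
  have inj: "inj_on f S1" and im: "f ` S1 = S1" using F(1) by (auto simp: Bij_def bij_betw_def)
  have fS: "f x \<in> S1" if "x \<in> S1" for x using that im by blast
  have gf: "g (f x) = x" if "x \<in> S1" for x using that fS inj by (simp add: g_def)
  have fg: "f (g x) = x" "g x \<in> S1" if "x \<in> S1" for x
    using that im inv_into_into[of x f S1] by (simp_all add: g_def f_inv_into_f)
  have FG: "F (G x) = x" for x using lift_surj[OF F(1,3,4)] by (simp add: G_def surj_f_inv_f)
  have GF: "G (F x) = x" for x using F(4) by (simp add: G_def strict_mono_imp_inj_on)
  have 1: "g \<in> Bij S1" unfolding g_def using F(1) by (rule restrict_inv_into_Bij)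
  have mono: "G x < G y \<longleftrightarrow> x < y" for x y using FG F(4) strict_mono_less by metis
  have 4: "strict_mono G" using mono by (simp add: strict_mono_def)
  have "surj G" using GF by (metis surjI)
  then have "continuous_on UNIV G"
    using mono by (intro continuous_onI_mono) (auto simp: less_eq_real_def)
  moreover have "frac (G x) = g (frac x)" for x
    using F(3) FG gf frac_S1 by (metis is_lift_def)
  ultimately have 3: "is_lift G g" by (simp add: is_lift_def)
  have 2: "homeomorphic_map circle circle g"
    unfolding homeomorphic_map_maps homeomorphic_maps_def
    using is_lift_continuous_map[OF 3] is_lift_continuous_map[OF F(3)] gf fg by auto
  have 6: "g ` (S1 \<inter> dyadics) \<subseteq> dyadics"
    using dyadic_preimage[OF F(1,3,5,6)] fg by auto
  obtain B where B: "finite B" "B \<subseteq> S1 \<inter> dyadics" 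
    "\<And>a b. a < b \<Longrightarrow> (\<forall>x\<in>{a<..<b}. frac x \<notin> B) \<Longrightarrow>
        (\<exists>(k::int) c. \<forall>x\<in>{a..b}. F x = 2 powi k * x + c)"
    using F(5) unfolding dyadic_PL_def by metis
  have "dyadic_PL G" unfolding dyadic_PL_def
  proof (intro exI[of _ "f ` B"] conjI allI impI)
    show "finite (f ` B)" using B by simp
    show "f ` B \<subseteq> S1 \<inter> dyadics" using B F(6) fS by blast
    fix a b :: real assume ab: "a < b \<and> (\<forall>x\<in>{a<..<b}. frac x \<notin> f ` B)"
    have "\<forall>x\<in>{G a<..<G b}. frac x \<notin> B"
    proof
      fix x assume x: "x \<in> {G a<..<G b}"
      then have "F x \<in> {a<..<b}" using mono GF by (metis greaterThanLessThan_iff)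
      then have "frac (F x) \<notin> f ` B" using ab by blast
      then show "frac x \<notin> B" using F(3) by (auto simp: is_lift_def)
    qed
    then obtain k c where kc: "\<And>x. x\<in>{G a..G b} \<Longrightarrow> F x = 2 powi k * x + c"
      using B(3)[of "G a" "G b"] mono ab by blast
    have "G x = 2 powi (-k) * x + (- (2 powi (-k)) * c)" if "x \<in> {a..b}" for x
    proof -
      have "G x \<in> {G a..G b}" using that 4 by (auto simp: strict_mono_less_eq)
      from kc[OF this] have "x = 2 powi k * G x + c" by (simp add: FG)
      then have "2 powi (-k) * x = G x + 2 powi (-k) * c" by (simp add: power_int_minus field_simps)
      then show ?thesis by simp
    qed
    then show "\<exists>(k::int) c. \<forall>x\<in>{a..b}. G x = 2 powi k * x + c" by blast
  qed
  then show ?thesis using 1 2 3 4 6 unfolding thompson_T_maps_def g_def by blast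
qed

lemma T_id: "(\<lambda>x\<in>S1. x) \<in> thompson_T_maps"
proof -
  have "homeomorphic_map circle circle id" by (simp add: homeomorphic_map_id)
  then have h: "homeomorphic_map circle circle (\<lambda>x\<in>S1. x)" by (rule homeomorphic_map_eq) auto
  have "is_lift (\<lambda>x. x) (\<lambda>x\<in>S1. x)" using frac_S1 by (auto simp: is_lift_def)
  moreover have "strict_mono (\<lambda>x::real. x)" by (simp add: strict_mono_def)
  moreover have "dyadic_PL (\<lambda>x. x)" unfolding dyadic_PL_def
    by (intro exI[of _ "{}"]) (auto intro!: exI[of _ 0])
  moreover have "(\<lambda>x\<in>S1. x) ` (S1 \<inter> dyadics) \<subseteq> dyadics" by auto
  ultimately show ?thesis using h id_Bij unfolding thompson_T_maps_def by blast
qed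

lemma group_thompson_T: "group thompson_T"
proof -
  interpret BG: group "BijGroup S1" by (rule group_BijGroup)
  have sub: "thompson_T_maps \<subseteq> Bij S1" by (auto simp: thompson_T_maps_def)
  have "subgroup thompson_T_maps (BijGroup S1)"
  proof (rule BG.subgroupI)
    show "thompson_T_maps \<subseteq> carrier (BijGroup S1)" using sub by (simp add: BijGroup_def)
    show "thompson_T_maps \<noteq> {}" using T_id by blast
    show "inv\<^bsub>BijGroup S1\<^esub> a \<in> thompson_T_maps" if "a \<in> thompson_T_maps" for a
      using that sub T_inverse by (auto simp: inv_BijGroup)
    show "a \<otimes>\<^bsub>BijGroup S1\<^esub> b \<in> thompson_T_maps" if "a \<in> thompson_T_maps" "b \<in> thompson_T_maps" for a b
      using that sub T_compose by (auto simp: BijGroup_def)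
  qed
  then show ?thesis unfolding thompson_T_def by (rule BG.subgroup_imp_group)
qed

lemma I_left_mono: "k \<le> n + 1 \<Longrightarrow> I_left n k < I_left n (Suc k)"
  by (auto simp: I_left_def field_simps)

lemma I_left_le: "k \<le> l \<Longrightarrow> I_left n k \<le> I_left n l"
  by (rule lift_Suc_mono_le[of "I_left n"]) (auto simp: I_left_def field_simps)

lemma thompson_c_piece:
  assumes "k \<le> n + 1" "x \<in> {I_left n k..<I_left n (k + 1)}"
  shows "thompson_c n x = (let k' = (if k = 0 then n + 1 else k - 1)
     in affine_onto (I_left n k) (I_left n (k + 1)) (I_left n k') (I_left n (k' + 1)) x)"
proof -
  have "l = k" if "l \<le> n + 1 \<and> x \<in> {I_left n l..<I_left n (l + 1)}" for l
  proof (rule linorder_cases[of l k])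
    assume "l < k" then show ?thesis using I_left_le[of "l+1" k n] assms that by auto
  next
    assume "k < l" then show ?thesis using I_left_le[of "k+1" l n] assms that by auto
  qed
  then have "(THE l. l \<le> n + 1 \<and> x \<in> {I_left n l..<I_left n (l + 1)}) = k"
    using assms by (intro the_equality) blast+
  moreover have "x \<in> S1"
  proof -
    have "I_left n 0 = 0" "I_left n (n+2) = 1" by (auto simp: I_left_def)
    then show ?thesis using assms I_left_le[of 0 k n] I_left_le[of "k+1" "n+2" n] by auto
  qed
  ultimately show ?thesis unfolding thompson_c_def by (simp only: restrict_apply' Let_def)
qed

lemma thompson_c_formula:
  assumes "x \<in> S1"
  shows "thompson_c n x = (if x < 1/2 then 1 - 1/2^(n+1) + x / 2^n
     else if x < 1 - 1/2^(n+1) then 2 * x - 1 else x - 1/2^(n+1))"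
proof (cases "x < 1/2")
  case True
  then have "x \<in> {I_left n 0..<I_left n (0+1)}" using assms by (auto simp: I_left_def)
  from thompson_c_piece[OF _ this] have
    "thompson_c n x = affine_onto (I_left n 0) (I_left n 1) (I_left n (n+1)) (I_left n (n+1+1)) x" by (simp add: Let_def)
  also have "\<dots> = 1 - 1/2^(n+1) + x / 2^n" by (simp add: affine_onto_def I_left_def)
  finally show ?thesis using True by simp
next
  case False
  show ?thesis
  proof (cases "x < 1 - 1/2^(n+1)")
    case True
    define k where "k = (GREATEST k. k \<le> n + 1 \<and> I_left n k \<le> x)"
    have k: "k \<le> n + 1 \<and> I_left n k \<le> x" unfolding k_def
      by (rule GreatestI_nat[where b="n+1" and k=0]) (use assms in \<open>auto simp: I_left_def\<close>)
    have kn: "k \<noteq> n + 1" using True k by (auto simp: I_left_def)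
    have k0: "k \<noteq> 0"
    proof
      assume "k = 0"
      moreover have "1 \<le> k" unfolding k_def using False
        by (intro Greatest_le_nat[where b="n+1"]) (auto simp: I_left_def)
      ultimately show False by simp
    qed
    have "\<not> I_left n (k+1) \<le> x"
    proof
      assume "I_left n (k+1) \<le> x"
      then have "k + 1 \<le> k" unfolding k_def using k kn 
        by (intro Greatest_le_nat[where b="n+1"]) (auto simp: k_def)
      then show False by simp
    qed
    with k have "x \<in> {I_left n k..<I_left n (k+1)}" by auto
    from thompson_c_piece[OF _ this] k k0 kn obtain j where j: "k = Suc j" "j < n" 
      "thompson_c n x = affine_onto (I_left n k) (I_left n (k + 1)) (I_left n j) (I_left n (j + 1)) x"
      by (cases k) (auto simp: Let_def)
    have e: "I_left n k = 1 - (1/2^j)/2" "I_left n (k+1) = 1 - (1/2^j)/4" "I_left n j = 1 - 1/2^j" "I_left n (j+1) = 1 - (1/2^j)/2"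
      using j by (auto simp: I_left_def)
    define e where "e = (1::real)/2^j"
    have "e > 0" by (simp add: e_def)
    have "thompson_c n x = 2 * x - 1" unfolding j(3) e affine_onto_def e_def[symmetric] using \<open>e > 0\<close>
      by (simp add: field_simps)
    then show ?thesis using True False by simp
  next
    case F: False
    then have "x \<in> {I_left n (n+1)..<I_left n (n+1+1)}" using assms by (auto simp: I_left_def)
    from thompson_c_piece[OF _ this] have
      "thompson_c n x = affine_onto (I_left n (n+1)) (I_left n (n+1+1)) (I_left n n) (I_left n (n+1)) x" by (simp add: Let_def)
    also have "\<dots> = x - 1/2^(n+1)" by (simp add: affine_onto_def I_left_def)
    finally show ?thesis using F False by simp
  qed
qed


lemma homeo_of_lift:
  assumes f: "f \<in> Bij S1" and F: "is_lift F f" "strict_mono F"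
  shows "homeomorphic_map circle circle f"
proof -
  define g where "g = (\<lambda>x\<in>S1. inv_into S1 f x)"
  define G where "G = inv_into UNIV F"
  have inj: "inj_on f S1" and im: "f ` S1 = S1" using f by (auto simp: Bij_def bij_betw_def)
  have fS: "f x \<in> S1" if "x \<in> S1" for x using that im by blast
  have gf: "g (f x) = x" if "x \<in> S1" for x using that fS inj by (simp add: g_def)
  have fg: "f (g x) = x" "g x \<in> S1" if "x \<in> S1" for x
    using that im inv_into_into[of x f S1] by (simp_all add: g_def f_inv_into_f)
  have FG: "F (G x) = x" for x using lift_surj[OF f F] by (simp add: G_def surj_f_inv_f)
  have GF: "G (F x) = x" for x using F(2) by (simp add: G_def strict_mono_imp_inj_on)
  have mono: "G x < G y \<longleftrightarrow> x < y" for x y using FG F(2) strict_mono_less by metis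
  have "surj G" using GF by (metis surjI)
  then have "continuous_on UNIV G"
    using mono by (intro continuous_onI_mono) (auto simp: less_eq_real_def)
  moreover have "frac (G x) = g (frac x)" for x
    using F(1) FG gf frac_S1 by (metis is_lift_def)
  ultimately have 3: "is_lift G g" by (simp add: is_lift_def)
  show ?thesis
    unfolding homeomorphic_map_maps homeomorphic_maps_def
    using is_lift_continuous_map[OF 3] is_lift_continuous_map[OF F(1)] gf fg by auto
qed

lemma thompson_c_in_T: "thompson_c n \<in> carrier thompson_T"
proof -
  define e where "e = (1::real)/2^(n+1)"
  have e: "0 < e" "e \<le> 1/2" by (auto simp: e_def field_simps)
  have e2: "x / 2^n = 2 * e * x" for x by (simp add: e_def)
  define \<phi> where "\<phi> t = (if t < 1/2 then 1 - e + 2*e*t else if t < 1 - e then 2*t else t + 1 - e)" for t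
  define F where "F x = of_int \<lfloor>x\<rfloor> + \<phi> (frac x)" for x
  let ?c = "thompson_c n"
  have p: "e * t < e * s" if "t < s" for t s using that e by simp
  have pmono: "\<phi> t < \<phi> s" if "t < s" for t s
  proof -
    have "t < 1/2 \<longrightarrow> 2 * e * t < e" using p[of t "1/2"] by (auto simp: mult_ac)
    moreover have "2 * e * t < 2 * e * s" using p[OF that] by simp
    ultimately show ?thesis using that e unfolding \<phi>_def
      by (cases "t < 1/2"; cases "s < 1/2"; cases "t < 1 - e"; cases "s < 1 - e"; simp only: if_True if_False; linarith)
  qed
  have p0: "\<phi> 0 = 1 - e" and p1: "\<phi> 1 = 2 - e" using e by (auto simp: \<phi>_def)
  have pr: "1 - e \<le> \<phi> t" "\<phi> t < 2 - e" if "t \<in> S1" for t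
    using pmono[of 0 t] pmono[of t 1] p0 p1 that by (cases "t = 0"; auto)+
  have sm: "strict_mono F"
  proof (rule strict_monoI)
    fix x y :: real assume xy: "x < y"
    show "F x < F y"
    proof (cases "\<lfloor>x\<rfloor> = \<lfloor>y\<rfloor>")
      case True
      then show ?thesis using xy pmono[of "frac x" "frac y"] by (auto simp: F_def frac_def)
    next
      case False
      then have "\<lfloor>x\<rfloor> + 1 \<le> \<lfloor>y\<rfloor>" using floor_mono[of x y] xy by linarith
      then have "real_of_int \<lfloor>x\<rfloor> + 1 \<le> real_of_int \<lfloor>y\<rfloor>" by linarith
      then show ?thesis using pr[OF frac_S1, of x] pr[OF frac_S1, of y] by (simp add: F_def)
    qed
  qed
  have Fm: "F (of_int m + t) = of_int m + \<phi> t" if "t \<in> S1" for m t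
  proof -
    have "\<lfloor>of_int m + t\<rfloor> = m" using that by (intro floor_unique) auto
    then show ?thesis by (simp add: F_def frac_def)
  qed
  have sj: "\<exists>x. F x = z" for z
  proof -
    define m where "m = \<lfloor>z - (1 - e)\<rfloor>"
    define s where "s = z - of_int m"
    have s: "1 - e \<le> s" "s < 2 - e" unfolding s_def m_def by linarith+
    define t where "t = (if s < 1 then (s - 1 + e)/(2*e) else if s < 2 - 2*e then s/2 else s - 1 + e)"
    have "\<phi> t = s \<and> t \<in> S1"
    proof (cases "s < 1")
      case True
      then have "t = (s-1+e)/(2*e)" by (simp add: t_def)
      moreover have "t \<ge> 0" "t < 1/2" unfolding calculation using True e s
        by (auto simp: divide_less_eq intro: divide_nonneg_pos)
      ultimately show ?thesis using e by (simp add: \<phi>_def)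
    next
      case False
      then show ?thesis using e s by (auto simp: t_def \<phi>_def)
    qed
    then have "F (of_int m + t) = z" using Fm by (simp add: s_def)
    then show ?thesis by blast
  qed
  have "surj F" using sj by (metis surjI)
  then have cont: "continuous_on UNIV F"
    using sm by (intro continuous_onI_mono) (auto simp: strict_mono_less_eq)
  have cphi: "?c t = frac (\<phi> t)" if t: "t \<in> S1" for t
  proof -
    have "frac (\<phi> t) = \<phi> t - (if t < 1/2 then 0 else 1)"
    proof (cases "t < 1/2")
      case True
      have "e * t < e * (1/2)" using p[of t "1/2"] True by simp
      moreover have "0 \<le> e * t" using e t by simp
      ultimately show ?thesis using True e by (simp add: \<phi>_def frac_eq)
    next
      case False
      have "\<lfloor>\<phi> t\<rfloor> = 1" using False t e by (intro floor_unique) (auto simp: \<phi>_def)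
      then show ?thesis using False by (simp add: frac_def)
    qed
    then show ?thesis unfolding thompson_c_formula[OF t] e_def[symmetric] e2 by (auto simp: \<phi>_def)
  qed
  have cF: "frac (F x) = ?c (frac x)" for x
    using cphi[OF frac_S1] by (simp add: F_def frac_def)
  have lift: "is_lift F ?c" using cont cF by (simp add: is_lift_def)
  have bij: "?c \<in> Bij S1"
  proof -
    have "inj_on ?c S1"
    proof (rule inj_onI)
      fix x y assume x: "x \<in> S1" and y: "y \<in> S1" and eq: "?c x = ?c y"
      then have "\<phi> x - \<phi> y = of_int (\<lfloor>\<phi> x\<rfloor> - \<lfloor>\<phi> y\<rfloor>)" by (simp add: cphi frac_def)
      moreover have "\<bar>\<phi> x - \<phi> y\<bar> < 1" using pr[OF x] pr[OF y] by auto
      ultimately have "\<phi> x - \<phi> y = of_int (\<lfloor>\<phi> x\<rfloor> - \<lfloor>\<phi> y\<rfloor>)" "\<bar>\<lfloor>\<phi> x\<rfloor> - \<lfloor>\<phi> y\<rfloor>\<bar> < 1"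
        by (simp, metis of_int_abs of_int_less_1_iff)
      then have "\<phi> x = \<phi> y" by simp
      then show "x = y" using pmono[of x y] pmono[of y x] by linarith
    qed
    moreover have "?c ` S1 = S1"
    proof
      show "?c ` S1 \<subseteq> S1" using frac_S1 by (auto simp: cphi simp del: atLeastLessThan_iff)
      show "S1 \<subseteq> ?c ` S1"
      proof
        fix y assume y: "y \<in> S1"
        obtain x where "F x = y" using sj by blast
        then have "?c (frac x) = y" using cF[of x] frac_id[OF y] by simp
        then show "y \<in> ?c ` S1" using frac_S1 by blast
      qed
    qed
    ultimately show ?thesis by (simp add: Bij_def bij_betw_def thompson_c_def)
  qed
  have De: "e \<in> signed_dyadics" unfolding signed_dyadics_def e_def by (auto intro!: exI[of _ 1] exI[of _ "n+1"])
  have Dh: "1/2 \<in> signed_dyadics" unfolding signed_dyadics_def by (auto intro!: exI[of _ 1] exI[of _ "1::nat"])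
  have D1: "1 \<in> signed_dyadics" "2 \<in> signed_dyadics" "0 \<in> signed_dyadics" using Dy_int[of 1] Dy_int[of 2] Dy_int[of 0] by auto
  have dy: "?c ` (S1 \<inter> dyadics) \<subseteq> dyadics"
  proof
    fix y assume "y \<in> ?c ` (S1 \<inter> dyadics)"
    then obtain x where x: "x \<in> S1" "x \<in> signed_dyadics" "y = frac (\<phi> x)" by (auto simp: dyadics_iff_signed cphi simp del: atLeastLessThan_iff)
    have "\<phi> x \<in> signed_dyadics" unfolding \<phi>_def using x(2) De D1
      by (auto intro!: Dy_add Dy_diff Dy_mult)
    then show "y \<in> dyadics" using x(3) by (simp add: dyadics_iff_signed Dy_frac_iff)
  qed
  have ph: "\<phi> t = 1 - e + 2*e*t" if "t \<le> 1/2" for t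
  proof (cases "t = 1/2")
    case True
    show ?thesis unfolding True using e by (simp add: \<phi>_def)
  next
    case False
    then show ?thesis using that by (simp add: \<phi>_def)
  qed
  have ph2: "\<phi> t = 2*t" if "1/2 \<le> t" "t \<le> 1 - e" for t
    using that by (auto simp: \<phi>_def)
  have ph3: "\<phi> t = t + 1 - e" if "1 - e \<le> t" for t
  proof -
    have "\<not> t < 1/2" "\<not> t < 1 - e" using that e by auto
    then show ?thesis by (simp add: \<phi>_def)
  qed
  have pl: "dyadic_PL F" unfolding dyadic_PL_def
  proof (intro exI[of _ "{0, 1/2, 1 - e}"] conjI allI impI)
    show "{0, 1/2, 1 - e} \<subseteq> S1 \<inter> dyadics" using e Dh De D1 Dy_diff[of 1 e] by (auto simp: dyadics_iff_signed)
    fix a b :: real assume ab: "a < b \<and> (\<forall>x\<in>{a<..<b}. frac x \<notin> {0, 1/2, 1 - e})"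
    define m where "m = \<lfloor>a\<rfloor>"
    have no: "of_int m + t \<notin> {a<..<b}" if "t \<in> {0,1/2,1-e}" for t
    proof
      assume "of_int m + t \<in> {a<..<b}"
      moreover have "frac (of_int m + t) = t" using that e by (auto simp: frac_unique_iff)
      ultimately show False using ab that by metis
    qed
    have no1: "of_int m + 1 \<notin> {a<..<b}"
    proof
      assume "of_int m + 1 \<in> {a<..<b}"
      moreover have "frac (of_int m + 1 :: real) = 0" by simp
      ultimately show False using ab by (metis insertI1)
    qed
    have am: "of_int m \<le> a" "a < of_int m + 1" by (simp_all add: m_def)
    have bm: "b \<le> of_int m + 1" using no1 am by auto
    have FF: "F x = of_int m + \<phi> (x - of_int m)" if "x \<in> {a..b}" for x
    proof (cases "x = of_int m + 1")
      case True
      then show ?thesis using Fm[of 0 "m+1"] p0 p1 by simp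
    next
      case False
      then show ?thesis using Fm[of "x - of_int m" m] am bm that by auto
    qed
    have "of_int m + 1/2 \<le> a \<or> b \<le> of_int m + 1/2" "of_int m + (1 - e) \<le> a \<or> b \<le> of_int m + (1 - e)"
      using no[of "1/2"] no[of "1-e"] unfolding greaterThanLessThan_iff by (meson insertI1 insertI2 not_less)+
    then consider "b \<le> of_int m + 1/2" | "of_int m + 1/2 \<le> a" "b \<le> of_int m + (1 - e)" | "of_int m + (1 - e) \<le> a"
      by metis
    then show "\<exists>(k::int) c. \<forall>x\<in>{a..b}. F x = 2 powi k * x + c"
    proof cases
      case 1
      have k: "2 powi (- int n) = 2 * e" by (simp add: e_def power_int_minus inverse_eq_divide)
      have "F x = 2 powi (- int n) * x + (of_int m + 1 - e - 2 * e * of_int m)" if "x \<in> {a..b}" for x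
      proof -
        have "x - of_int m \<le> 1/2" using 1 that by auto
        from ph[OF this] FF[OF that] k show ?thesis by (simp add: right_diff_distrib)
      qed
      then show ?thesis by blast
    next
      case 2
      have "F x = 2 powi 1 * x + (- of_int m)" if "x \<in> {a..b}" for x
      proof -
        have "1/2 \<le> x - of_int m" "x - of_int m \<le> 1 - e" using 2 that by auto
        from ph2[OF this] FF[OF that] show ?thesis by simp
      qed
      then show ?thesis by blast
    next
      case 3
      have "F x = 2 powi 0 * x + (1 - e)" if "x \<in> {a..b}" for x
      proof -
        have "1 - e \<le> x - of_int m" using 3 that by auto
        from ph3[OF this] FF[OF that] show ?thesis by simp
      qed
      then show ?thesis by blast
    qed
  qed simp_all
  show ?thesis using bij homeo_of_lift[OF bij lift sm] lift sm pl dy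
    unfolding thompson_T_def thompson_T_maps_def by auto
qed

end

theory Submission
  imports Defs
begin

text \<open>A torsion element and a suitable power of some \<open>c_n\<close> are matched through their lifts to the line.
  The lifts of elements of \<open>T\<close> form a group \<open>lifted_T\<close> of increasing maps commuting with \<open>x \<mapsto> x + 1\<close>,
  and two lifts of one element differ by an integer translation.

  Let \<open>g\<close> have order \<open>m\<close> and let \<open>F\<close> be a lift. Then \<open>F^m\<close> lifts the identity, so it is a translation
  by some integer \<open>p\<close>. An increasing map with an iterate equal to the identity is the identity; applied to a
  translate of an iterate of \<open>F\<close> this shows that \<open>p\<close> and \<open>m\<close> are coprime. By a Bezout identity the cyclic
  group generated by \<open>g\<close> then has a generator \<open>k\<close> with a lift \<open>K\<close> such that \<open>K^m\<close> is the unit translation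
  (lemma \<open>generator_with_unit_translation\<close>).

  Any two such maps \<open>K\<close> and \<open>E\<close> with the same \<open>m\<close> are conjugate (lemma \<open>roots_of_translation_conjugate\<close>).
  Indeed \<open>[0, K 0)\<close> is a fundamental domain for \<open>K\<close>, any two dyadic intervals are related by a dyadic
  piecewise linear homeomorphism \<open>h\<close>, and the one from \<open>[0, K 0]\<close> to \<open>[0, E 0]\<close> extends equivariantly by
  \<open>K^i t \<mapsto> E^i (h t)\<close>. So finite cyclic subgroups of \<open>T\<close> of equal order are conjugate.

  Since \<open>c_n\<close> has order \<open>n + 2\<close> (lemma \<open>ord_thompson_c\<close>), every order \<open>m \<ge> 2\<close> occurs among
  the \<open>c_n\<close>, and a torsion element of order \<open>m\<close> is conjugate to a power of \<open>c_(m-2)\<close>; the identity is \<open>c_0^0\<close>. The converse holds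
  because a conjugate of a torsion element is torsion.\<close>

section \<open>Dyadic piecewise linear maps between dyadic intervals\<close>

text \<open>Piecewise linear maps on one compact interval are described by concatenation of affine pieces with
  dyadic data. The inductive form replaces bookkeeping with breakpoint sets: closure under composition and
  inversion follows by rule induction.\<close>
inductive dyadic_PL_on :: "(real \<Rightarrow> real) \<Rightarrow> real \<Rightarrow> real \<Rightarrow> bool" for F where
  affine: "a \<in> signed_dyadics \<Longrightarrow> b \<in> signed_dyadics \<Longrightarrow> c \<in> signed_dyadics \<Longrightarrow> a < b
    \<Longrightarrow> (\<And>z. z \<in> {a..b} \<Longrightarrow> F z = 2 powi k * z + c) \<Longrightarrow> dyadic_PL_on F a b"
| join: "dyadic_PL_on F a m \<Longrightarrow> dyadic_PL_on F m b \<Longrightarrow> dyadic_PL_on F a b"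

lemma dyadic_PL_on_endpoints:
  assumes "dyadic_PL_on F a b"
  shows "a < b \<and> F a < F b \<and> a \<in> signed_dyadics \<and> b \<in> signed_dyadics
    \<and> F a \<in> signed_dyadics \<and> F b \<in> signed_dyadics"
  using assms
proof induction
  case (affine a b c k)
  then show ?case by (auto intro!: Dy_add Dy_mult Dy_pow)
qed auto

lemma dyadic_PL_on_strict_mono:
  assumes "dyadic_PL_on F a b" "x \<in> {a..b}" "y \<in> {a..b}" "x < y"
  shows "F x < F y"
  using assms
proof (induction arbitrary: x y)
  case (affine a b c k)
  then show ?case by simp
next
  case (join a m b)
  have am: "a < m" "m < b" using join.hyps dyadic_PL_on_endpoints by blast+
  consider "y \<le> m" | "m \<le> x" | "x < m" "m < y" by linarith
  then show ?case
  proof cases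
    case 3
    then have "F x < F m" "F m < F y" using join.IH join.prems am by auto
    then show ?thesis by simp
  qed (use join in auto)
qed

lemma dyadic_PL_on_surj:
  assumes "dyadic_PL_on F a b" "y \<in> {F a..F b}"
  shows "\<exists>x\<in>{a..b}. F x = y"
  using assms
proof (induction arbitrary: y)
  case (affine a b c k)
  define x where "x = (y - c) / 2 powi k"
  have p: "(2::real) powi k > 0" by simp
  have "2 powi k * a + c \<le> y" "y \<le> 2 powi k * b + c" using affine by auto
  then have "x \<in> {a..b}" using p by (auto simp: x_def field_simps)
  moreover from this have "F x = y" using affine.hyps(5)[of x] by (simp add: x_def)
  ultimately show ?case by blast
next
  case (join a m b)
  have am: "a < m" "m < b" using join.hyps dyadic_PL_on_endpoints by blast+
  show ?case
  proof (cases "y \<le> F m")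
    case True
    then obtain x where "x \<in> {a..m}" "F x = y" using join.IH(1)[of y] join.prems by auto
    then show ?thesis using am by (intro bexI[of _ x]) auto
  next
    case False
    then obtain x where "x \<in> {m..b}" "F x = y" using join.IH(2)[of y] join.prems by auto
    then show ?thesis using am by (intro bexI[of _ x]) auto
  qed
qed

lemma dyadic_PL_on_cong:
  assumes "dyadic_PL_on F a b" "\<And>z. z \<in> {a..b} \<Longrightarrow> G z = F z"
  shows "dyadic_PL_on G a b"
  using assms
proof induction
  case (affine a b c k)
  then show ?case by (intro dyadic_PL_on.affine[of a b c _ k]) auto
next
  case (join a m b)
  have am: "a < m" "m < b" using join.hyps dyadic_PL_on_endpoints by blast+
  show ?case by (rule dyadic_PL_on.join[of _ _ m]) (use join am in auto)
qed

lemma dyadic_PL_on_subinterval: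
  assumes "dyadic_PL_on F a b" "a \<le> c" "c < d" "d \<le> b" "c \<in> signed_dyadics" "d \<in> signed_dyadics"
  shows "dyadic_PL_on F c d"
  using assms
proof (induction arbitrary: c d)
  case (affine a b l k)
  then show ?case by (intro dyadic_PL_on.affine[of c d l _ k]) auto
next
  case (join a m b)
  have m: "m \<in> signed_dyadics" using join.hyps dyadic_PL_on_endpoints by blast
  consider "d \<le> m" | "m \<le> c" | "c < m" "m < d" by linarith
  then show ?case
  proof cases
    case 3
    then show ?thesis using join m by (intro dyadic_PL_on.join[of _ c m d]) auto
  qed (use join in auto)
qed

text \<open>Precomposition with an affine map pulls the pieces of \<open>G\<close> back to dyadic pieces, since the inverse
  affine map has again a power of 2 as slope and a dyadic constant.\<close>
lemma dyadic_PL_on_compose_affine: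
  assumes "dyadic_PL_on G c d" "2 powi k * a + l = c" "2 powi k * b + l = d"
    "a \<in> signed_dyadics" "b \<in> signed_dyadics" "l \<in> signed_dyadics"
  shows "dyadic_PL_on (\<lambda>x. G (2 powi k * x + l)) a b"
  using assms
proof (induction arbitrary: a b)
  case (affine c d l' k')
  have "2 powi k * a < 2 powi k * b" using affine.hyps(4) affine.prems by linarith
  then have "a < b" by simp
  show ?case
  proof (rule dyadic_PL_on.affine[of a b "2 powi k' * l + l'" _ "k' + k"])
    fix z assume z: "z \<in> {a..b}"
    then have "2 powi k * a \<le> 2 powi k * z" "2 powi k * z \<le> 2 powi k * b" by auto
    then have "2 powi k * z + l \<in> {c..d}" using affine.prems by auto
    then show "G (2 powi k * z + l) = 2 powi (k' + k) * z + (2 powi k' * l + l')"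
      by (simp add: affine.hyps(5) power_int_add algebra_simps)
  qed (use affine \<open>a < b\<close> in \<open>auto intro!: Dy_add Dy_mult Dy_pow\<close>)
next
  case (join c m d)
  have m: "m \<in> signed_dyadics" using join.hyps dyadic_PL_on_endpoints by blast
  define n where "n = 2 powi (-k) * (m - l)"
  have "2 powi k * n + l = m" by (simp add: n_def power_int_minus field_simps)
  moreover have "n \<in> signed_dyadics" using m join.prems unfolding n_def
    by (intro Dy_mult Dy_pow Dy_diff)
  ultimately show ?case using join by (intro dyadic_PL_on.join[of _ a n b]) auto
qed

lemma dyadic_PL_on_compose:
  assumes "dyadic_PL_on F a b" "dyadic_PL_on G (F a) (F b)"
  shows "dyadic_PL_on (\<lambda>x. G (F x)) a b"
  using assms
proof induction
  case (affine a b c k)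
  have "F a = 2 powi k * a + c" "F b = 2 powi k * b + c" using affine.hyps by auto
  then have "dyadic_PL_on (\<lambda>x. G (2 powi k * x + c)) a b"
    using dyadic_PL_on_compose_affine[OF affine.prems] affine.hyps by auto
  then show ?case by (rule dyadic_PL_on_cong) (simp add: affine.hyps(5))
next
  case (join a m b)
  have "F a < F m" "F m < F b" "F m \<in> signed_dyadics" "F a \<in> signed_dyadics" "F b \<in> signed_dyadics"
    using join.hyps dyadic_PL_on_endpoints by blast+
  then show ?case using join dyadic_PL_on_subinterval[OF join.prems]
    by (intro dyadic_PL_on.join[of _ a m b]) auto
qed

lemma dyadic_PL_on_inverse:
  assumes "dyadic_PL_on F a b" "\<And>z. z \<in> {a..b} \<Longrightarrow> G (F z) = z"
  shows "dyadic_PL_on G (F a) (F b)"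
  using assms
proof induction
  case (affine a b c k)
  have pl: "dyadic_PL_on F a b" by (rule dyadic_PL_on.affine[OF affine.hyps])
  show ?case
  proof (rule dyadic_PL_on.affine[of "F a" "F b" "- (2 powi (-k) * c)" _ "-k"])
    show "G w = 2 powi - k * w + - (2 powi - k * c)" if w: "w \<in> {F a..F b}" for w
    proof -
      obtain z where z: "z \<in> {a..b}" "F z = w" using dyadic_PL_on_surj[OF pl w] by blast
      have "w = 2 powi k * z + c" using affine.hyps(5)[OF z(1)] z(2) by simp
      then show ?thesis using affine.prems[OF z(1)] z(2)
        by (simp add: power_int_minus field_simps)
    qed
    show "- (2 powi - k * c) \<in> signed_dyadics" using affine.hyps(3) by (intro Dy_uminus Dy_mult Dy_pow)
  qed (use dyadic_PL_on_endpoints[OF pl] in auto)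
next
  case (join a m b)
  have am: "a < m" "m < b" using join.hyps dyadic_PL_on_endpoints by blast+
  then show ?case using join by (intro dyadic_PL_on.join[of _ "F a" "F m" "F b"]) auto
qed

text \<open>All intervals \<open>[0, a]\<close> with dyadic \<open>a > 0\<close> are equivalent under dyadic piecewise linear maps fixing 0.
  Scaling by powers of 2 reduces to integer lengths, and an interval of length \<open>n + 2\<close> is compressed to length 2
  by mapping its first \<open>n + 1\<close> units to one unit and translating the last unit; halving then gives length 1.\<close>
lemma dyadic_PL_on_exists:
  assumes "a \<in> signed_dyadics" "b \<in> signed_dyadics" "0 < a" "0 < b"
  shows "\<exists>h. dyadic_PL_on h 0 a \<and> h 0 = 0 \<and> h a = b"
proof -
  let ?E = "\<lambda>a b. \<exists>h. dyadic_PL_on h 0 a \<and> h 0 = 0 \<and> h a = b"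
  have zero: "0 \<in> signed_dyadics" using Dy_int[of 0] by simp
  have trans: "?E a c" if ab: "?E a b" and bc: "?E b c" for a b c
  proof -
    obtain f g where f: "dyadic_PL_on f 0 a" "f 0 = 0" "f a = b"
      and g: "dyadic_PL_on g 0 b" "g 0 = 0" "g b = c" using ab bc by blast
    then show ?thesis using dyadic_PL_on_compose[OF f(1), of g]
      by (intro exI[of _ "\<lambda>x. g (f x)"]) auto
  qed
  have sym: "?E b a" if ab: "?E a b" for a b
  proof -
    obtain f where f: "dyadic_PL_on f 0 a" "f 0 = 0" "f a = b" using ab by blast
    have a0: "0 < a" using dyadic_PL_on_endpoints[OF f(1)] by simp
    define g where "g = inv_into {0..a} f"
    have "inj_on f {0..a}"
      by (rule linorder_inj_onI) (use dyadic_PL_on_strict_mono[OF f(1)] in fastforce)+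
    then have g: "g (f z) = z" if "z \<in> {0..a}" for z using that by (simp add: g_def)
    have "dyadic_PL_on g (f 0) (f a)" by (rule dyadic_PL_on_inverse[OF f(1) g])
    then show ?thesis using f g[of 0] g[of a] a0 by (intro exI[of _ g]) auto
  qed
  have scale: "?E a (2 powi k * a)" if "a \<in> signed_dyadics" "0 < a" for a k
    by (intro exI[of _ "\<lambda>z. 2 powi k * z"] conjI dyadic_PL_on.affine[of 0 a 0 _ k]) (use that zero in auto)
  have nat: "?E (real (Suc n)) 1" for n
  proof (induction n)
    case 0
    show ?case using scale[of 1 0] Dy_int[of 1] by auto
  next
    case (Suc n)
    then obtain h where h: "dyadic_PL_on h 0 (real (Suc n))" "h 0 = 0" "h (real (Suc n)) = 1" by blast
    define h' where "h' = (\<lambda>x. if x \<le> real (Suc n) then h x else x - real n)"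
    have "dyadic_PL_on h' 0 (real (Suc n))"
      by (rule dyadic_PL_on_cong[OF h(1)]) (simp add: h'_def)
    moreover have "dyadic_PL_on h' (real (Suc n)) (real (Suc (Suc n)))"
    proof (rule dyadic_PL_on.affine[of _ _ "- real n" _ 0])
      show "real (Suc n) \<in> signed_dyadics" "real (Suc (Suc n)) \<in> signed_dyadics" "- real n \<in> signed_dyadics"
        using Dy_int[of "int (Suc n)"] Dy_int[of "int (Suc (Suc n))"] Dy_int[of "- int n"] by simp_all
      show "h' z = 2 powi 0 * z + - real n"
        if "z \<in> {real (Suc n)..real (Suc (Suc n))}" for z
        using that h(3) by (cases "z = real (Suc n)") (auto simp: h'_def)
    qed simp
    ultimately have "dyadic_PL_on h' 0 (real (Suc (Suc n)))" by (rule dyadic_PL_on.join)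
    then have "?E (real (Suc (Suc n))) 2" using h by (intro exI[of _ h']) (simp add: h'_def)
    moreover have "?E 2 1" using scale[of 2 "-1"] Dy_int[of 2] by (simp add: power_int_minus)
    ultimately show ?case by (rule trans)
  qed
  \<comment> \<open>Clearing the denominator is a scaling by a power of 2.\<close>
  have unit: "?E a 1" if a: "a \<in> signed_dyadics" "0 < a" for a
  proof -
    obtain m k where mk: "a = of_int m / 2 ^ k" using a by (auto simp: signed_dyadics_def)
    then have "m > 0" using a(2) by (simp add: zero_less_divide_iff)
    then obtain n where n: "m = int (Suc n)" by (metis Suc_pred zero_less_nat_eq nat_0_le less_imp_le)
    have "2 powi int k * a = real (Suc n)" by (simp add: mk n)
    then have "?E a (real (Suc n))" using scale[OF a, of "int k"] by metis
    then show ?thesis using nat by (rule trans)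
  qed
  show ?thesis by (rule trans[OF unit sym[OF unit]]) (use assms in auto)
qed

text \<open>This and the next lemma translate between the inductive description and descriptions by a finite set of
  breakpoints, as in \<^const>\<open>dyadic_PL\<close>.\<close>
lemma dyadic_PL_on_breakpoints:
  assumes "dyadic_PL_on F a b"
  shows "\<exists>B. finite B \<and> B \<subseteq> signed_dyadics \<inter> {a..b} \<and>
    (\<forall>c d. a \<le> c \<and> c < d \<and> d \<le> b \<and> {c<..<d} \<inter> B = {} \<longrightarrow>
      (\<exists>(k::int) l. \<forall>x\<in>{c..d}. F x = 2 powi k * x + l))"
  using assms
proof induction
  case (affine a b l k)
  then show ?case by (intro exI[of _ "{}"]) fastforce
next
  case (join a m b)
  obtain A where A: "finite A" "A \<subseteq> signed_dyadics \<inter> {a..m}"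
    "\<And>c d. a \<le> c \<Longrightarrow> c < d \<Longrightarrow> d \<le> m \<Longrightarrow> {c<..<d} \<inter> A = {} \<Longrightarrow>
      (\<exists>(k::int) l. \<forall>x\<in>{c..d}. F x = 2 powi k * x + l)" using join.IH(1) by metis
  obtain B where B: "finite B" "B \<subseteq> signed_dyadics \<inter> {m..b}"
    "\<And>c d. m \<le> c \<Longrightarrow> c < d \<Longrightarrow> d \<le> b \<Longrightarrow> {c<..<d} \<inter> B = {} \<Longrightarrow>
      (\<exists>(k::int) l. \<forall>x\<in>{c..d}. F x = 2 powi k * x + l)" using join.IH(2) by metis
  have m: "a < m" "m < b" "m \<in> signed_dyadics" using join.hyps dyadic_PL_on_endpoints by blast+
  show ?case
  proof (intro exI[of _ "insert m (A \<union> B)"] conjI allI impI)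
    fix c d assume cd: "a \<le> c \<and> c < d \<and> d \<le> b \<and> {c<..<d} \<inter> insert m (A \<union> B) = {}"
    then have "d \<le> m \<or> m \<le> c" by force
    then show "\<exists>(k::int) l. \<forall>x\<in>{c..d}. F x = 2 powi k * x + l"
      using A(3)[of c d] B(3)[of c d] cd by blast
  qed (use A B m in auto)
qed

text \<open>The interval is cut at one interior breakpoint after another, by induction on their number. The constant
  term of each piece is dyadic because the map sends a dyadic endpoint of the piece to a dyadic number.\<close>
lemma dyadic_PL_on_if_finite_breakpoints:
  assumes "finite B" "B \<subseteq> signed_dyadics" "\<And>x. x \<in> signed_dyadics \<Longrightarrow> F x \<in> signed_dyadics"
    and affine: "\<And>c d. a \<le> c \<Longrightarrow> c < d \<Longrightarrow> d \<le> b \<Longrightarrow> {c<..<d} \<inter> B = {} \<Longrightarrow>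
      \<exists>(k::int) l. \<forall>x\<in>{c..d}. F x = 2 powi k * x + l"
    and "c \<in> signed_dyadics" "d \<in> signed_dyadics" "a \<le> c" "c < d" "d \<le> b"
  shows "dyadic_PL_on F c d"
  using assms(5-)
proof (induction "card ({c<..<d} \<inter> B)" arbitrary: c d rule: less_induct)
  case less
  show ?case
  proof (cases "{c<..<d} \<inter> B = {}")
    case True
    then obtain k l where kl: "\<And>x. x \<in> {c..d} \<Longrightarrow> F x = 2 powi k * x + l"
      using affine[of c d] less.prems by metis
    have "F c = 2 powi k * c + l" using kl less.prems by auto
    then have "l = F c - 2 powi k * c" by simp
    moreover have "F c - 2 powi k * c \<in> signed_dyadics"
      using assms(3) less.prems by (intro Dy_diff Dy_mult Dy_pow) auto
    ultimately show ?thesis using less.prems kl by (intro dyadic_PL_on.affine[of c d l _ k]) auto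
  next
    case False
    then obtain m where m: "c < m" "m < d" "m \<in> B" by auto
    have "card ({c<..<m} \<inter> B) < card ({c<..<d} \<inter> B)" "card ({m<..<d} \<inter> B) < card ({c<..<d} \<inter> B)"
      by (rule psubset_card_mono; use m assms(1) in force)+
    then show ?thesis using less m assms(2) by (intro dyadic_PL_on.join[of _ c m d]) auto
  qed
qed

section \<open>The group of lifts\<close>

text \<open>The lifts of the elements of \<open>T\<close>. One period determines a lift, so monotonicity, surjectivity and
  piecewise linearity on all dyadic intervals are consequences of these two conditions.\<close>
definition lifted_T :: "(real \<Rightarrow> real) set" where
  "lifted_T = {F. (\<forall>x. F (x + 1) = F x + 1) \<and> dyadic_PL_on F 0 1}"

definition circle_map :: "(real \<Rightarrow> real) \<Rightarrow> real \<Rightarrow> real" where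
  "circle_map F = (\<lambda>x\<in>S1. frac (F x))"

lemma lifted_T_add_of_int:
  assumes "F \<in> lifted_T"
  shows "F (x + of_int n) = F x + of_int n"
proof -
  have 1: "F (x + 1) = F x + 1" for x using assms by (simp add: lifted_T_def)
  have nat: "F (x + of_nat k) = F x + of_nat k" for x k
  proof (induction k)
    case (Suc k)
    then show ?case using 1[of "x + of_nat k"] by (simp add: algebra_simps)
  qed simp
  show ?thesis
  proof (cases "n \<ge> 0")
    case True
    then show ?thesis using nat[of x "nat n"] by simp
  next
    case False
    then show ?thesis using nat[of "x + of_int n" "nat (-n)"] by simp
  qed
qed

lemma lifted_T_dyadic_PL_on:
  assumes F: "F \<in> lifted_T" and "a \<in> signed_dyadics" "b \<in> signed_dyadics" "a < b"
  shows "dyadic_PL_on F a b"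
proof -
  have one: "dyadic_PL_on F (of_int i) (of_int i + 1)" for i
  proof -
    have "dyadic_PL_on F 0 1" using F by (simp add: lifted_T_def)
    then have "dyadic_PL_on (\<lambda>x. F (x + of_int (- i))) (of_int i) (of_int i + 1)"
      using dyadic_PL_on_compose_affine[of F 0 1 0 "of_int i" "of_int (- i)" "of_int i + 1"]
        Dy_int[of i] Dy_int[of "i + 1"] Dy_int[of "-i"] by simp
    moreover have "dyadic_PL_on (\<lambda>x. x + of_int i) (F 0) (F 1)"
      using Dy_int[of i] dyadic_PL_on_endpoints[OF \<open>dyadic_PL_on F 0 1\<close>]
      by (intro dyadic_PL_on.affine[of _ _ "of_int i" _ 0]) auto
    ultimately have "dyadic_PL_on (\<lambda>x. F (x + of_int (- i)) + of_int i) (of_int i) (of_int i + 1)"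
      using dyadic_PL_on_compose[of "\<lambda>x. F (x + of_int (- i))" "of_int i" "of_int i + 1" "\<lambda>x. x + of_int i"]
      by simp
    then show ?thesis
      by (rule dyadic_PL_on_cong) (use lifted_T_add_of_int[OF F] in \<open>metis add.commute add.left_commute add_0 ab_left_minus of_int_0 of_int_add add.right_neutral\<close>)
  qed
  have many: "dyadic_PL_on F (of_int i) (of_int i + real (Suc n))" for i n
  proof (induction n)
    case 0
    show ?case using one[of i] by simp
  next
    case (Suc n)
    have "dyadic_PL_on F (of_int i + real (Suc n)) (of_int i + real (Suc (Suc n)))"
      using one[of "i + int (Suc n)"] by (simp add: algebra_simps)
    with Suc show ?case by (rule dyadic_PL_on.join)
  qed
  define n where "n = nat (\<lceil>b\<rceil> - \<lfloor>a\<rfloor>)"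
  have "of_int \<lfloor>a\<rfloor> \<le> a" by linarith
  moreover have "\<lfloor>a\<rfloor> \<le> \<lceil>b\<rceil>" using assms(4) by linarith
  then have "of_int \<lfloor>a\<rfloor> + real (Suc n) = of_int \<lceil>b\<rceil> + 1" by (simp add: n_def)
  then have "b \<le> of_int \<lfloor>a\<rfloor> + real (Suc n)" by linarith
  ultimately show ?thesis using assms by (intro dyadic_PL_on_subinterval[OF many[of "\<lfloor>a\<rfloor>" n]]) auto
qed

lemma lifted_T_strict_mono:
  assumes "F \<in> lifted_T"
  shows "strict_mono F"
proof (rule strict_monoI)
  fix x y :: real assume "x < y"
  have "of_int \<lfloor>x\<rfloor> < of_int \<lceil>y\<rceil> + (1::real)" using \<open>x < y\<close> by linarith
  moreover have "of_int \<lceil>y\<rceil> + 1 \<in> signed_dyadics" using Dy_int[of "\<lceil>y\<rceil> + 1"] by simp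
  ultimately have "dyadic_PL_on F (of_int \<lfloor>x\<rfloor>) (of_int \<lceil>y\<rceil> + 1)"
    using assms Dy_int lifted_T_dyadic_PL_on by auto
  then show "F x < F y" by (rule dyadic_PL_on_strict_mono) (use \<open>x < y\<close> in simp_all, linarith+)
qed

lemma lifted_T_surj:
  assumes "F \<in> lifted_T"
  shows "surj F"
proof -
  have "\<exists>x. F x = y" for y
  proof -
    define n where "n = \<lfloor>y - F 0\<rfloor>"
    have e: "F (of_int i) = F 0 + of_int i" for i using lifted_T_add_of_int[OF assms, of 0] by simp
    have "dyadic_PL_on F (of_int n) (of_int (n + 1))"
      by (rule lifted_T_dyadic_PL_on[OF assms Dy_int Dy_int]) simp
    moreover have "y \<in> {F (of_int n)..F (of_int (n + 1))}"
      unfolding e n_def by (auto; linarith)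
    ultimately show ?thesis using dyadic_PL_on_surj by blast
  qed
  then show ?thesis by (metis surjI)
qed

lemma lifted_T_signed_dyadics:
  assumes "F \<in> lifted_T" "x \<in> signed_dyadics"
  shows "F x \<in> signed_dyadics"
proof -
  have "x + 1 \<in> signed_dyadics" using Dy_add[OF assms(2) Dy_int[of 1]] by simp
  then have "dyadic_PL_on F x (x + 1)" using assms lifted_T_dyadic_PL_on by simp
  then show ?thesis using dyadic_PL_on_endpoints by blast
qed

lemma lifted_T_compose:
  assumes "F \<in> lifted_T" "G \<in> lifted_T"
  shows "G \<circ> F \<in> lifted_T"
proof -
  have F: "dyadic_PL_on F 0 1" using assms by (simp add: lifted_T_def)
  have "dyadic_PL_on G (F 0) (F 1)"
    using dyadic_PL_on_endpoints[OF F] assms(2) lifted_T_dyadic_PL_on by blast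
  from dyadic_PL_on_compose[OF F this] show ?thesis using assms by (simp add: lifted_T_def comp_def)
qed

lemma lifted_T_translation: "(\<lambda>x. x + of_int n) \<in> lifted_T"
  unfolding lifted_T_def using Dy_int[of 0] Dy_int[of 1] Dy_int[of n]
  by (auto intro!: dyadic_PL_on.affine[of 0 1 "of_int n" _ 0])

lemma lifted_T_funpow:
  assumes "F \<in> lifted_T"
  shows "F ^^ n \<in> lifted_T"
proof (induction n)
  case 0
  show ?case using lifted_T_translation[of 0] by (simp add: id_def)
next
  case (Suc n)
  then show ?case using lifted_T_compose[OF Suc assms] by (simp only: funpow.simps)
qed

text \<open>Maps in \<^const>\<open>lifted_T\<close> commute with integer translations, so the translations accumulate.\<close>
lemma lifted_T_translated_funpow:
  assumes F: "F \<in> lifted_T"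
  shows "((\<lambda>x. F x + of_int a) ^^ n) x = (F ^^ n) x + of_int (int n * a)"
proof (induction n)
  case (Suc n)
  show ?case
    using lifted_T_add_of_int[OF F, of "(F ^^ n) x" "int n * a"] Suc by (simp add: algebra_simps)
qed simp

lemma lifted_T_continuous:
  assumes "F \<in> lifted_T"
  shows "continuous_on UNIV F"
  using lifted_T_strict_mono[OF assms] lifted_T_surj[OF assms]
  by (intro continuous_onI_mono) (auto simp: strict_mono_less_eq)

lemma lifted_T_is_lift:
  assumes "F \<in> lifted_T"
  shows "is_lift F (circle_map F)"
proof -
  have "frac (F x) = circle_map F (frac x)" for x
  proof -
    have "F x = F (frac x) + of_int \<lfloor>x\<rfloor>" using lifted_T_add_of_int[OF assms, of "frac x" "\<lfloor>x\<rfloor>"] by (simp add: frac_def)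
    then have "frac (F x) = frac (F (frac x))" by simp
    then show ?thesis using frac_S1[of x] by (simp add: circle_map_def)
  qed
  then show ?thesis using lifted_T_continuous[OF assms] by (simp add: is_lift_def)
qed

text \<open>The point 0 is added to the breakpoints on the circle, so that an interval avoiding all of them lies
  between two consecutive integers and is a translate of an interval in \<open>[0, 1]\<close>.\<close>
lemma lifted_T_dyadic_PL:
  assumes F: "F \<in> lifted_T"
  shows "dyadic_PL F"
proof -
  have "dyadic_PL_on F 0 1" using F by (simp add: lifted_T_def)
  from dyadic_PL_on_breakpoints[OF this] obtain B where B: "finite B" "B \<subseteq> signed_dyadics \<inter> {0..1}"
    "\<And>c d. 0 \<le> c \<Longrightarrow> c < d \<Longrightarrow> d \<le> 1 \<Longrightarrow> {c<..<d} \<inter> B = {} \<Longrightarrow>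
      (\<exists>(k::int) l. \<forall>x\<in>{c..d}. F x = 2 powi k * x + l)" by metis
  show ?thesis unfolding dyadic_PL_def
  proof (intro exI[of _ "frac ` insert 0 B"] conjI allI impI)
    show "finite (frac ` insert 0 B)" using B by simp
    show "frac ` insert 0 B \<subseteq> S1 \<inter> dyadics"
      using B(2) Dy_int[of 0] by (auto simp: frac_lt_1 dyadics_iff_signed Dy_frac_iff)
    fix a b :: real assume ab: "a < b \<and> (\<forall>x\<in>{a<..<b}. frac x \<notin> frac ` insert 0 B)"
    define n where "n = \<lfloor>a\<rfloor>"
    have an: "of_int n \<le> a" "a < of_int n + 1" by (simp_all add: n_def)
    have bn: "b \<le> of_int n + 1"
    proof (rule ccontr)
      assume "\<not> b \<le> of_int n + 1"
      then have "of_int (n + 1) \<in> {a<..<b}" using an by auto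
      then have "frac (of_int (n + 1) :: real) \<notin> frac ` insert 0 B" using ab by blast
      then show False by simp
    qed
    have "{a - of_int n<..<b - of_int n} \<inter> B = {}"
    proof (rule ccontr)
      assume "{a - of_int n<..<b - of_int n} \<inter> B \<noteq> {}"
      then obtain x where x: "x \<in> B" "x + of_int n \<in> {a<..<b}" by (fastforce simp: algebra_simps)
      then have "frac (x + of_int n) \<notin> frac ` insert 0 B" using ab by blast
      then show False using x(1) by simp
    qed
    then obtain k l where kl: "\<And>x. x \<in> {a - of_int n..b - of_int n} \<Longrightarrow> F x = 2 powi k * x + l"
      using B(3)[of "a - of_int n" "b - of_int n"] an bn ab by auto
    have "F x = 2 powi k * x + (of_int n + l - 2 powi k * of_int n)" if "x \<in> {a..b}" for x
      using kl[of "x - of_int n"] that lifted_T_add_of_int[OF F, of "x - of_int n" n]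
      by (simp add: algebra_simps)
    then show "\<exists>(k::int) c. \<forall>x\<in>{a..b}. F x = 2 powi k * x + c" by blast
  qed
qed

lemma circle_map_in_T:
  assumes F: "F \<in> lifted_T"
  shows "circle_map F \<in> carrier thompson_T"
proof -
  have sm: "strict_mono F" by (rule lifted_T_strict_mono[OF F])
  have F1: "F 1 = F 0 + 1" using F by (simp add: lifted_T_def) (metis add_0)
  have inj: "inj_on (circle_map F) S1"
  proof (rule inj_onI)
    fix x y assume x: "x \<in> S1" and y: "y \<in> S1" and eq: "circle_map F x = circle_map F y"
    have "F 0 \<le> F z \<and> F z < F 0 + 1" if "z \<in> S1" for z
      using that sm F1 strict_mono_less_eq[OF sm, of 0 z] strict_mono_less[OF sm, of z 1] by auto
    from this[OF x] this[OF y] have "\<bar>F x - F y\<bar> < 1" by linarith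
    moreover have d: "F x - F y = of_int (\<lfloor>F x\<rfloor> - \<lfloor>F y\<rfloor>)" using x y eq by (simp add: circle_map_def frac_def)
    ultimately have "\<bar>\<lfloor>F x\<rfloor> - \<lfloor>F y\<rfloor>\<bar> < 1" by linarith
    then have "F x = F y" using d by simp
    then show "x = y" using strict_mono_eq[OF sm] by blast
  qed
  have "circle_map F ` S1 = S1"
  proof
    show "circle_map F ` S1 \<subseteq> S1" using frac_S1 by (auto simp: circle_map_def frac_lt_1)
    show "S1 \<subseteq> circle_map F ` S1"
    proof
      fix y assume y: "y \<in> S1"
      obtain z where z: "F z = y" using lifted_T_surj[OF F] by (metis surjD)
      then have "circle_map F (frac z) = y" using lifted_T_is_lift[OF F] frac_id[OF y] by (metis is_lift_def)
      then show "y \<in> circle_map F ` S1" using frac_S1 by blast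
    qed
  qed
  with inj have bij: "circle_map F \<in> Bij S1" by (simp add: Bij_def bij_betw_def circle_map_def)
  have "circle_map F ` (S1 \<inter> dyadics) \<subseteq> dyadics"
    using lifted_T_signed_dyadics[OF F] by (auto simp: circle_map_def dyadics_iff_signed Dy_frac_iff)
  then show ?thesis
    using bij homeo_of_lift[OF bij lifted_T_is_lift[OF F] sm] lifted_T_is_lift[OF F] sm lifted_T_dyadic_PL[OF F]
    by (auto simp: thompson_T_def thompson_T_maps_def)
qed

lemma lifted_T_exists:
  assumes "f \<in> carrier thompson_T"
  shows "\<exists>F\<in>lifted_T. f = circle_map F"
proof -
  have "f \<in> thompson_T_maps" using assms by (simp add: thompson_T_def)
  then obtain F where F: "f \<in> Bij S1" "is_lift F f" "strict_mono F" "dyadic_PL F"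
     "f ` (S1 \<inter> dyadics) \<subseteq> dyadics" by (rule thompson_T_mapsE)
  have per: "F (x + 1) = F x + 1" for x
    using lift_periodic[OF _ F(2,3), of x 1] F(1) by (simp add: Bij_def bij_betw_def)
  have D: "F x \<in> signed_dyadics" if "x \<in> signed_dyadics" for x
  proof -
    have "frac x \<in> S1 \<inter> dyadics" using that frac_S1[of x] by (simp add: dyadics_iff_signed Dy_frac_iff)
    then have "frac (F x) \<in> dyadics" using F(2,5) by (auto simp: is_lift_def)
    then show ?thesis by (simp add: dyadics_iff_signed Dy_frac_iff)
  qed
  obtain B where B: "finite B" "B \<subseteq> S1 \<inter> dyadics"
    "\<And>a b. a < b \<Longrightarrow> (\<forall>x\<in>{a<..<b}. frac x \<notin> B) \<Longrightarrow>
        (\<exists>(k::int) c. \<forall>x\<in>{a..b}. F x = 2 powi k * x + c)"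
    using F(4) unfolding dyadic_PL_def by metis
  have "dyadic_PL_on F 0 1"
  proof (rule dyadic_PL_on_if_finite_breakpoints[of B F 0 1])
    fix c d :: real assume cd: "0 \<le> c" "c < d" "d \<le> 1" "{c<..<d} \<inter> B = {}"
    have "frac x \<notin> B" if "x \<in> {c<..<d}" for x
      using that cd frac_id[of x] by auto
    then show "\<exists>(k::int) l. \<forall>x\<in>{c..d}. F x = 2 powi k * x + l" using B(3) cd by blast
  qed (use B D Dy_int[of 0] Dy_int[of 1] in \<open>auto simp: dyadics_iff_signed\<close>)
  then have "F \<in> lifted_T" using per by (simp add: lifted_T_def)
  moreover have "f = circle_map F"
  proof (rule extensionalityI)
    show "f \<in> extensional S1" using F(1) by (simp add: Bij_def)
    show "f x = circle_map F x" if "x \<in> S1" for x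
      using that F(2) frac_id[of x] by (simp add: circle_map_def is_lift_def)
  qed (simp add: circle_map_def)
  ultimately show ?thesis by blast
qed

lemma circle_map_compose:
  assumes "F \<in> lifted_T" "G \<in> lifted_T"
  shows "circle_map (G \<circ> F) = circle_map G \<otimes>\<^bsub>thompson_T\<^esub> circle_map F"
proof -
  have "circle_map F \<in> Bij S1" "circle_map G \<in> Bij S1"
    using circle_map_in_T assms by (auto simp: thompson_T_def thompson_T_maps_def)
  then have "circle_map G \<otimes>\<^bsub>thompson_T\<^esub> circle_map F = compose S1 (circle_map G) (circle_map F)"
    by (simp add: thompson_T_def BijGroup_def)
  moreover have "circle_map (G \<circ> F) x = compose S1 (circle_map G) (circle_map F) x" for x
  proof (cases "x \<in> S1")
    case True
    then have "circle_map F x = frac (F x)" "circle_map (G \<circ> F) x = frac (G (F x))"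
      by (simp_all add: circle_map_def)
    with True show ?thesis using lifted_T_is_lift[OF assms(2)]
      by (simp add: compose_eq is_lift_def del: atLeastLessThan_iff)
  next
    case False
    then show ?thesis by (simp only: compose_def circle_map_def restrict_apply if_False)
  qed
  ultimately show ?thesis by auto
qed

lemma circle_map_one: "circle_map (\<lambda>x. x + of_int n) = \<one>\<^bsub>thompson_T\<^esub>"
  by (auto simp: circle_map_def thompson_T_def BijGroup_def frac_eq restrict_def)

lemma circle_map_funpow:
  assumes "F \<in> lifted_T"
  shows "circle_map (F ^^ n) = circle_map F [^]\<^bsub>thompson_T\<^esub> n"
proof (induction n)
  case 0
  show ?case using circle_map_one[of 0] by (simp add: id_def)
next
  case (Suc n)
  show ?case unfolding funpow_Suc_right nat_pow_Suc Suc[symmetric]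
    by (rule circle_map_compose[OF assms lifted_T_funpow[OF assms]])
qed

text \<open>The difference of two lifts is continuous with values in the integers, hence constant on the line.\<close>
lemma circle_map_eqD:
  assumes F: "F \<in> lifted_T" and G: "G \<in> lifted_T" and eq: "circle_map F = circle_map G"
  shows "\<exists>n. \<forall>x. F x = G x + of_int n"
proof -
  define d where "d x = \<lfloor>F x\<rfloor> - \<lfloor>G x\<rfloor>" for x
  have "frac (F x) = frac (G x)" for x
    using lifted_T_is_lift[OF F] lifted_T_is_lift[OF G] eq by (simp add: is_lift_def)
  then have d: "F x - G x = of_int (d x)" for x by (simp add: frac_def d_def) (metis add_diff_eq diff_add_cancel diff_diff_eq2 add.commute)
  have "(\<lambda>x. F x - G x) constant_on UNIV"
  proof (rule continuous_discrete_range_constant)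
    show "continuous_on UNIV (\<lambda>x. F x - G x)"
      by (intro continuous_on_diff lifted_T_continuous F G)
    show "\<exists>e>0. \<forall>y. y \<in> UNIV \<and> F y - G y \<noteq> F x - G x \<longrightarrow> e \<le> norm (F y - G y - (F x - G x))" for x
    proof (intro exI[of _ 1] conjI allI impI)
      fix y assume "y \<in> UNIV \<and> F y - G y \<noteq> F x - G x"
      then have "d y \<noteq> d x" by (simp add: d)
      then have "1 \<le> \<bar>d y - d x\<bar>" by linarith
      then have "1 \<le> \<bar>of_int (d y - d x) :: real\<bar>" by linarith
      then show "1 \<le> norm (F y - G y - (F x - G x))" unfolding d by simp
    qed simp
  qed simp
  then obtain c where "\<And>x. F x - G x = c" by (auto simp: constant_on_def)
  then have "F x - G x = of_int (d 0)" for x using d[of 0] by simp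
  then have "F x = G x + of_int (d 0)" for x by (metis add.commute diff_add_cancel)
  then show ?thesis by blast
qed

lemma thompson_T_mult_apply:
  assumes "g \<in> carrier thompson_T" "h \<in> carrier thompson_T" "x \<in> S1"
  shows "(g \<otimes>\<^bsub>thompson_T\<^esub> h) x = g (h x)"
  using assms by (simp add: thompson_T_def thompson_T_maps_def BijGroup_def compose_eq)

lemma thompson_T_pow_apply:
  assumes "g \<in> carrier thompson_T" "x \<in> S1"
  shows "(g [^]\<^bsub>thompson_T\<^esub> (n::nat)) x = (g ^^ n) x"
  using assms(2)
proof (induction n arbitrary: x)
  case 0
  then show ?case by (simp add: thompson_T_def BijGroup_def)
next
  case (Suc n)
  interpret T: group thompson_T by (rule group_thompson_T)
  have "g [^]\<^bsub>thompson_T\<^esub> n \<in> carrier thompson_T" using assms(1) by simp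
  note p = this
  have "g \<in> Bij S1" using assms(1) by (simp add: thompson_T_def thompson_T_maps_def)
  then have "g x \<in> S1" using Suc.prems Bij_imp_funcset by blast
  then have "(g ^^ Suc n) x = (g [^]\<^bsub>thompson_T\<^esub> n) (g x)"
    using Suc.IH by (simp add: funpow_Suc_right del: funpow.simps atLeastLessThan_iff)
  also have "\<dots> = (g [^]\<^bsub>thompson_T\<^esub> Suc n) x"
    by (simp only: nat_pow_Suc thompson_T_mult_apply[OF p assms(1) Suc.prems])
  finally show ?case by simp
qed

section \<open>A generator of a finite cyclic subgroup whose lift is a root of the unit translation\<close>

text \<open>If a point moves, monotonicity moves it further in the same direction under iteration, and it never returns.\<close>
lemma strict_mono_funpow_eq_id:
  fixes f :: "'a::linorder \<Rightarrow> 'a"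
  assumes f: "strict_mono f" and "n > 0" "\<And>x. (f ^^ n) x = x"
  shows "f x = x"
proof -
  obtain k where k: "n = Suc k" using \<open>n > 0\<close> by (cases n) auto
  have "x < (f ^^ Suc i) x" if "x < f x" for i
  proof (induction i)
    case (Suc i)
    then have "f x < f ((f ^^ Suc i) x)" using f by (simp add: strict_mono_def)
    with that show ?case by simp
  qed (use that in simp)
  moreover have "(f ^^ Suc i) x < x" if "f x < x" for i
  proof (induction i)
    case (Suc i)
    then have "f ((f ^^ Suc i) x) < f x" using f by (simp add: strict_mono_def)
    with that show ?case by simp
  qed (use that in simp)
  ultimately show ?thesis using assms(3)[of x] unfolding k by (metis less_irrefl linorder_neqE)
qed

text \<open>In terms of rotation numbers: \<open>g\<close> has rotation number \<open>p / m\<close> in lowest terms, and a power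
  \<open>g^d\<close> with \<open>d p \<equiv> 1\<close> modulo \<open>m\<close> has rotation number \<open>1 / m\<close>.\<close>
lemma generator_with_unit_translation:
  assumes g: "g \<in> carrier thompson_T" and m: "group.ord thompson_T g = m" "m > 0"
  obtains K d j where "K \<in> lifted_T" "\<And>x. (K ^^ m) x = x + 1"
    "circle_map K = g [^]\<^bsub>thompson_T\<^esub> (d::nat)" "g = circle_map K [^]\<^bsub>thompson_T\<^esub> (j::int)"
proof -
  interpret T: group thompson_T by (rule group_thompson_T)
  obtain F where F: "F \<in> lifted_T" "g = circle_map F" using lifted_T_exists[OF g] by blast
  have "circle_map (F ^^ m) = circle_map (\<lambda>x. x + of_int 0)"
    unfolding circle_map_funpow[OF F(1)] circle_map_one F(2)[symmetric] m(1)[symmetric] using g by simp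
  from circle_map_eqD[OF lifted_T_funpow[OF F(1)] lifted_T_translation this]
  obtain p where p: "\<And>x. (F ^^ m) x = x + of_int p" by auto
  have pk: "((F ^^ m) ^^ k) x = x + of_int (int k * p)" for k x
    by (induction k) (simp_all add: p algebra_simps)
  define q where "q = nat (gcd p (int m))"
  have q: "q > 0" "int q = gcd p (int m)" using m(2) by (simp_all add: q_def)
  have "int q dvd p" "int q dvd int m" using q(2) by simp_all
  then obtain p' m' where pm: "p = int q * p'" "m = q * m'" unfolding int_dvd_int_iff by (auto elim!: dvdE)
  \<comment> \<open>If \<open>q > 1\<close>, then \<open>m'\<close> would be a smaller exponent killing \<open>g\<close>: the iterate \<open>A\<close> is a
    \<open>q\<close>-th root of the translation by \<open>q p'\<close> and hence equal to the translation by \<open>p'\<close>.\<close>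
  define A where "A = F ^^ m'"
  define A' where "A' = (\<lambda>x. A x + of_int (- p'))"
  have A: "A \<in> lifted_T" unfolding A_def by (rule lifted_T_funpow[OF F(1)])
  have A'_in: "A' \<in> lifted_T"
    using lifted_T_compose[OF A lifted_T_translation[of "- p'"]] by (simp add: A'_def comp_def)
  have "(A' ^^ q) x = x" for x
  proof -
    have "(A' ^^ q) x = (A ^^ q) x - of_int p"
      unfolding A'_def lifted_T_translated_funpow[OF A] by (simp add: pm)
    also have "(A ^^ q) x = x + of_int p"
      using p[of x] by (simp add: A_def funpow_mult pm mult.commute)
    finally show ?thesis by simp
  qed
  from strict_mono_funpow_eq_id[OF lifted_T_strict_mono[OF A'_in] q(1) this]
  have "A x = x + of_int p'" for x by (simp add: A'_def algebra_simps)
  then have "A = (\<lambda>x. x + of_int p')" by blast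
  then have "g [^]\<^bsub>thompson_T\<^esub> m' = \<one>\<^bsub>thompson_T\<^esub>"
    using circle_map_funpow[OF F(1), of m'] circle_map_one[of p'] F(2) by (simp add: A_def)
  then have "m dvd m'" using T.pow_eq_id[OF g] m(1) by simp
  moreover have "m' > 0" using pm(2) m(2) by (cases m') auto
  ultimately have "q * m' \<le> 1 * m'" using pm(2) dvd_imp_le by fastforce
  then have "q = 1" using q(1) \<open>m' > 0\<close> by (simp only: mult_le_cancel2) simp
  obtain u v where uv: "u * p + v * int m = 1"
    using bezout_int[of p "int m"] q(2) \<open>q = 1\<close> by auto
  \<comment> \<open>Reducing \<open>u\<close> modulo \<open>m\<close> makes the exponent a natural number and keeps the Bezout identity.\<close>
  define d where "d = nat (u mod int m)"
  define s where "s = v + (u div int m) * p"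
  have d: "int d = u mod int m" using m(2) by (simp add: d_def)
  have "u = int m * (u div int m) + int d" by (simp add: d)
  then have "(int m * (u div int m) + int d) * p + v * int m = 1" using uv by simp
  then have ds: "int d * p + int m * s = 1" unfolding s_def by (simp add: distrib_left distrib_right ac_simps)
  define K where "K = (\<lambda>x. (F ^^ d) x + of_int s)"
  have Fd: "F ^^ d \<in> lifted_T" by (rule lifted_T_funpow[OF F(1)])
  have Kc: "K = (\<lambda>x. x + of_int s) \<circ> F ^^ d" by (auto simp: K_def)
  have K: "K \<in> lifted_T" unfolding Kc by (rule lifted_T_compose[OF Fd lifted_T_translation])
  have Km: "(K ^^ m) x = x + 1" for x
  proof -
    have "((F ^^ d) ^^ m) x = x + of_int (int d * p)"
      using pk[of d x] by (simp add: funpow_mult mult.commute)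
    then have "(K ^^ m) x = x + of_int (int d * p + int m * s)"
      unfolding K_def lifted_T_translated_funpow[OF Fd] by simp
    then show ?thesis by (simp add: ds)
  qed
  have Kd: "circle_map K = g [^]\<^bsub>thompson_T\<^esub> d"
    unfolding Kc circle_map_compose[OF Fd lifted_T_translation] circle_map_one
      circle_map_funpow[OF F(1)] F(2)[symmetric] using g by simp
  have "g [^]\<^bsub>thompson_T\<^esub> (int m * - s) = \<one>\<^bsub>thompson_T\<^esub>"
    using g m(1) by (simp only: T.int_pow_eq_id) simp
  moreover have "int d * p = 1 + int m * - s" using ds by simp
  ultimately have "g [^]\<^bsub>thompson_T\<^esub> (int d * p) = g"
    using g by (simp only: T.int_pow_mult) simp
  then have "g = circle_map K [^]\<^bsub>thompson_T\<^esub> p"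
    using g by (simp add: Kd T.int_pow_pow flip: int_pow_int)
  with K Km Kd show ?thesis by (rule that)
qed

section \<open>Conjugacy of roots of the unit translation\<close>

text \<open>The images of \<open>[0, K 0)\<close> under the iterates of \<open>K\<close> follow each other on the half-line
  \<open>[0, \<infinity>)\<close> and tile it. Working on the half-line only needs natural exponents.\<close>
context
  fixes K :: "real \<Rightarrow> real" and m :: nat
  assumes K: "K \<in> lifted_T" and Km: "\<And>x. (K ^^ m) x = x + 1"
begin

lemma root_of_translation_pos: "0 < K 0"
proof (rule ccontr)
  assume "\<not> 0 < K 0"
  have "(K ^^ n) 0 \<le> 0" for n
  proof (induction n)
    case (Suc n)
    then have "K ((K ^^ n) 0) \<le> K 0" using lifted_T_strict_mono[OF K] by (simp add: strict_mono_less_eq)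
    with \<open>\<not> 0 < K 0\<close> show ?case by simp
  qed simp
  from this[of m] show False using Km[of 0] by simp
qed

lemma root_of_translation_orbit_mono: "i \<le> j \<Longrightarrow> (K ^^ i) 0 \<le> (K ^^ j) 0"
proof (rule lift_Suc_mono_le[of "\<lambda>i. (K ^^ i) 0"])
  fix n
  show "(K ^^ n) 0 \<le> (K ^^ Suc n) 0"
    using lifted_T_strict_mono[OF lifted_T_funpow[OF K, of n]] root_of_translation_pos
    by (simp add: funpow_Suc_right strict_mono_less_eq less_imp_le del: funpow.simps)
qed

lemma fundamental_domain_less:
  assumes "t \<in> {0..<K 0}" "s \<in> {0..<K 0}" "i < j"
  shows "(K ^^ i) t < (K ^^ j) s"
proof -
  have sm: "strict_mono (K ^^ n)" for n by (rule lifted_T_strict_mono[OF lifted_T_funpow[OF K]])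
  have "(K ^^ i) t < (K ^^ i) (K 0)" using assms by (simp add: strict_mono_less[OF sm])
  also have "\<dots> = (K ^^ Suc i) 0" by (simp add: funpow_Suc_right del: funpow.simps)
  also have "\<dots> \<le> (K ^^ j) 0" using assms by (intro root_of_translation_orbit_mono) simp
  also have "\<dots> \<le> (K ^^ j) s" using assms by (simp add: strict_mono_less_eq[OF sm])
  finally show ?thesis .
qed

lemma fundamental_domain_unique:
  assumes "t \<in> {0..<K 0}" "s \<in> {0..<K 0}" "(K ^^ i) t = (K ^^ j) s"
  shows "i = j \<and> t = s"
proof -
  have "i = j" using fundamental_domain_less[of t s i j] fundamental_domain_less[of s t j i] assms
    by (metis less_irrefl linorder_neqE_nat)
  then show ?thesis
    using assms(3) lifted_T_strict_mono[OF lifted_T_funpow[OF K]] by (simp add: strict_mono_eq)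
qed

lemma fundamental_domain_cover:
  assumes "0 \<le> x"
  obtains i t where "t \<in> {0..<K 0}" "x = (K ^^ i) t"
proof -
  \<comment> \<open>The orbit of 0 passes every natural number, so it is unbounded.\<close>
  have "((K ^^ m) ^^ n) 0 = real n" for n by (induction n) (simp_all add: Km)
  then have n: "(K ^^ (m * n)) 0 = real n" for n by (simp add: funpow_mult)
  obtain n where "x < real n" using reals_Archimedean2 by blast
  moreover have "(K ^^ (m * n)) 0 \<le> (K ^^ Suc (m * n)) 0" by (rule root_of_translation_orbit_mono) simp
  ultimately have ex: "\<exists>i. x < (K ^^ Suc i) 0" using n by (metis order_less_le_trans)
  define i where "i = (LEAST i. x < (K ^^ Suc i) 0)"
  have i: "x < (K ^^ Suc i) 0" unfolding i_def using ex by (rule LeastI_ex)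
  have i': "(K ^^ i) 0 \<le> x"
  proof (cases i)
    case (Suc k)
    then show ?thesis using not_less_Least[of k "\<lambda>i. x < (K ^^ Suc i) 0"] by (simp add: i_def not_less)
  qed (use assms in simp)
  have Ki: "K ^^ i \<in> lifted_T" by (rule lifted_T_funpow[OF K])
  obtain t where t: "(K ^^ i) t = x" using lifted_T_surj[OF Ki] by (metis surjD)
  have "0 \<le> t" using i' t strict_mono_less_eq[OF lifted_T_strict_mono[OF Ki], of 0 t] by simp
  moreover have "t < K 0" using i t strict_mono_less[OF lifted_T_strict_mono[OF Ki], of t "K 0"]
    by (simp add: funpow_Suc_right del: funpow.simps)
  ultimately show ?thesis using t by (intro that[of t i]) auto
qed

end

text \<open>On the half-line the conjugating map is \<open>K^i t \<mapsto> E^i (h t)\<close> for \<open>t\<close> in the fundamental domain. As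
  \<open>K^m\<close> and \<open>E^m\<close> are both the unit translation, its equivariance contains the compatibility with
  \<open>x \<mapsto> x + 1\<close> that extends it to the line.\<close>
lemma roots_of_translation_conjugate:
  assumes K: "K \<in> lifted_T" and Km: "\<And>x. (K ^^ m) x = x + 1"
    and E: "E \<in> lifted_T" and Em: "\<And>x. (E ^^ m) x = x + 1"
  shows "\<exists>H\<in>lifted_T. H \<circ> K = E \<circ> H"
proof -
  note unique = fundamental_domain_unique[OF K Km]
  note cover = fundamental_domain_cover[OF K Km]
  have pos: "0 < K 0" "0 < E 0"
    by (rule root_of_translation_pos[OF K Km], rule root_of_translation_pos[OF E Em])
  have zero: "0 \<in> signed_dyadics" using Dy_int[of 0] by simp
  have D: "K 0 \<in> signed_dyadics" "E 0 \<in> signed_dyadics"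
    using zero lifted_T_signed_dyadics[OF K] lifted_T_signed_dyadics[OF E] by simp_all
  obtain h where h: "dyadic_PL_on h 0 (K 0)" "h 0 = 0" "h (K 0) = E 0"
    using dyadic_PL_on_exists[OF D pos] by blast
  define Hp where "Hp x = (THE y. \<exists>i t. t \<in> {0..<K 0} \<and> x = (K ^^ i) t \<and> y = (E ^^ i) (h t))" for x
  have Hp: "Hp ((K ^^ i) t) = (E ^^ i) (h t)" if "t \<in> {0..<K 0}" for i t
    unfolding Hp_def using that unique by (intro the_equality) blast+
  \<comment> \<open>Because \<open>h\<close> maps \<open>K 0\<close> to \<open>E 0\<close>, the formula persists at the right end of the domain. This is what
    glues the pieces.\<close>
  have Hp_closed: "Hp ((K ^^ i) t) = (E ^^ i) (h t)" if "t \<in> {0..K 0}" for i t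
  proof (cases "t = K 0")
    case True
    have "Hp ((K ^^ Suc i) 0) = (E ^^ Suc i) (h 0)" using pos by (intro Hp) simp
    then show ?thesis using True h by (simp add: funpow_Suc_right del: funpow.simps)
  qed (use that Hp in auto)
  have equiv: "Hp ((K ^^ n) x) = (E ^^ n) (Hp x)" if x: "0 \<le> x" for n x
  proof -
    obtain i t where it: "t \<in> {0..<K 0}" "x = (K ^^ i) t" using cover[OF x] .
    have "Hp ((K ^^ (n + i)) t) = (E ^^ (n + i)) (h t)" by (rule Hp[OF it(1)])
    then show ?thesis using Hp[OF it(1), of i] it(2) by (simp add: funpow_add)
  qed
  have Hp_add: "Hp (x + real n) = Hp x + real n" if "0 \<le> x" for x n
  proof (induction n)
    case (Suc n)
    have "Hp (x + real n + 1) = Hp (x + real n) + 1"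
      using equiv[of "x + real n" m] that by (simp add: Km Em)
    with Suc show ?case by (simp add: algebra_simps)
  qed simp
  define H where "H x = Hp (frac x) + of_int \<lfloor>x\<rfloor>" for x
  have H_Hp: "H x = Hp x" if "0 \<le> x" for x
  proof -
    have "x = frac x + real (nat \<lfloor>x\<rfloor>)" using that by (simp add: frac_def)
    then show ?thesis using Hp_add[of "frac x" "nat \<lfloor>x\<rfloor>"] that by (simp add: H_def)
  qed
  have H_add: "H (x + of_int n) = H x + of_int n" for x n by (simp add: H_def)
  \<comment> \<open>On the \<open>i\<close>-th tile the map is the composition of \<open>K^(-i)\<close>, \<open>h\<close> and \<open>E^i\<close>.\<close>
  have piece: "dyadic_PL_on Hp ((K ^^ i) 0) ((K ^^ Suc i) 0)" for i
  proof -
    have Ki: "K ^^ i \<in> lifted_T" and Ei: "E ^^ i \<in> lifted_T"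
      using lifted_T_funpow K E by blast+
    define G where "G = inv_into UNIV (K ^^ i)"
    have G: "G ((K ^^ i) t) = t" for t
      using strict_mono_imp_inj_on[OF lifted_T_strict_mono[OF Ki]] by (simp add: G_def)
    have plK: "dyadic_PL_on (K ^^ i) 0 (K 0)" by (rule lifted_T_dyadic_PL_on[OF Ki zero D(1) pos(1)])
    have "dyadic_PL_on G ((K ^^ i) 0) ((K ^^ i) (K 0))" by (rule dyadic_PL_on_inverse[OF plK G])
    moreover have "dyadic_PL_on (E ^^ i) (h 0) (h (K 0))"
      using lifted_T_dyadic_PL_on[OF Ei zero D(2) pos(2)] h by simp
    from dyadic_PL_on_compose[OF h(1) this] have "dyadic_PL_on (\<lambda>x. (E ^^ i) (h x)) 0 (K 0)" .
    ultimately have "dyadic_PL_on (\<lambda>x. (E ^^ i) (h (G x))) ((K ^^ i) 0) ((K ^^ i) (K 0))"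
      using dyadic_PL_on_compose[of G _ _ "\<lambda>x. (E ^^ i) (h x)"] G by metis
    moreover have "Hp z = (E ^^ i) (h (G z))" if z: "z \<in> {(K ^^ i) 0..(K ^^ i) (K 0)}" for z
    proof -
      obtain t where "t \<in> {0..K 0}" "(K ^^ i) t = z" using dyadic_PL_on_surj[OF plK z] by blast
      then show ?thesis using Hp_closed G by metis
    qed
    ultimately have "dyadic_PL_on Hp ((K ^^ i) 0) ((K ^^ i) (K 0))" by (rule dyadic_PL_on_cong)
    then show ?thesis by (simp add: funpow_Suc_right del: funpow.simps)
  qed
  have "dyadic_PL_on Hp 0 ((K ^^ Suc n) 0)" for n
  proof (induction n)
    case 0
    show ?case using piece[of 0] by simp
  next
    case (Suc n)
    then show ?case using piece[of "Suc n"] by (rule dyadic_PL_on.join)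
  qed
  moreover have "m > 0" using Km[of 0] by (cases m) auto
  ultimately have "dyadic_PL_on Hp 0 1" using Km[of 0] by (metis Suc_pred add_0)
  then have "dyadic_PL_on H 0 1" by (rule dyadic_PL_on_cong) (simp add: H_Hp)
  then have "H \<in> lifted_T" using H_add[of _ 1] by (simp add: lifted_T_def)
  moreover have "H (K x) = E (H x)" for x
  proof -
    have x: "x = frac x + of_int \<lfloor>x\<rfloor>" by (simp add: frac_def)
    have "0 < K (frac x)"
      using pos(1) lifted_T_strict_mono[OF K] by (metis frac_ge_0 order_less_le_trans strict_mono_less_eq)
    then have "H (K (frac x)) = Hp (K (frac x))" by (simp add: H_Hp)
    also have "\<dots> = E (Hp (frac x))" using equiv[of "frac x" 1] by simp
    finally have "H (K (frac x) + of_int \<lfloor>x\<rfloor>) = E (Hp (frac x) + of_int \<lfloor>x\<rfloor>)"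
      by (simp add: H_add lifted_T_add_of_int[OF E])
    then show ?thesis using lifted_T_add_of_int[OF K, of "frac x" "\<lfloor>x\<rfloor>"] x by (simp add: H_def)
  qed
  ultimately show ?thesis by (intro bexI[of _ H]) auto
qed

section \<open>The order of the standard torsion elements\<close>

lemma thompson_c_second_half:
  assumes "x \<in> {1/2..<1}"
  shows "thompson_c n x = (if x < 1 - 1 / 2 ^ (n + 1) then 2 * x - 1 else x - 1 / 2 ^ (n + 1))"
  using assms by (simp add: thompson_c_formula)

text \<open>On \<open>I_0\<close> the map \<open>c_n\<close> is first affine onto \<open>I_(n+1)\<close>, then translates to \<open>I_n\<close>, and from there on it
  doubles the distance to 1, until after \<open>n + 2\<close> steps the distance \<open>1 - t\<close> of the starting point is restored.
  For \<open>t = 0\<close> this also gives the orbit of 0 from its third point on.\<close>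
lemma thompson_c_funpow_first_half:
  assumes "t \<in> {0..<1/2}" "i \<le> n"
  shows "(thompson_c n ^^ (i + 2)) t = 1 - 2 ^ i / 2 ^ n * (1 - t)"
  using assms(2)
proof (induction i)
  case 0
  define e where "e = (1::real) / 2 ^ (n + 1)"
  have e: "0 < e" "e \<le> 1/2" by (auto simp: e_def field_simps)
  have te: "t / 2 ^ n = 2 * e * t" "1 / 2 ^ n = 2 * e" by (simp_all add: e_def)
  have "0 \<le> e * t" "e * t < e * (1/2)" using e(1) assms(1) by simp_all
  then have y: "1 - e + 2 * e * t \<in> {1 - e..<1}" by (simp add: e(1))
  have ct: "thompson_c n t = 1 - e + 2 * e * t"
    using assms(1) by (subst thompson_c_formula) (auto simp: e_def)
  have "thompson_c n (1 - e + 2 * e * t) = 1 - e + 2 * e * t - e"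
    using y e thompson_c_second_half[of "1 - e + 2 * e * t" n, folded e_def] by auto
  then show ?case using ct te by (simp add: numeral_2_eq_2 right_diff_distrib)
next
  case (Suc i)
  define y where "y = 1 - 2 ^ i / 2 ^ n * (1 - t)"
  have "(2::real) ^ Suc i \<le> 2 ^ n" using Suc.prems by (intro power_increasing) auto
  then have "2 ^ i / 2 ^ n \<le> (1::real) / 2" by (simp add: field_simps)
  then have "2 ^ i / 2 ^ n * (1 - t) \<le> 1 / 2 * 1" using assms(1) by (intro mult_mono) auto
  then have y1: "1/2 \<le> y" by (simp add: y_def)
  have "(1::real) / 2 ^ n \<le> 2 ^ i / 2 ^ n" by (simp add: divide_right_mono)
  moreover have "1 / 2 ^ n * (1/2) < 1 / 2 ^ n * (1 - t)" using assms(1) by (intro mult_strict_left_mono) auto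
  moreover have "1 / 2 ^ n * (1 - t) \<le> 2 ^ i / 2 ^ n * (1 - t)"
    using calculation(1) assms(1) by (intro mult_right_mono) auto
  ultimately have y2: "y < 1 - 1 / 2 ^ (n + 1)" by (simp add: y_def)
  have yS: "y \<in> S1" using y1 y2 by (auto intro: less_trans)
  have "(thompson_c n ^^ (Suc i + 2)) t = thompson_c n y" using Suc by (simp add: y_def)
  also have "\<dots> = 2 * y - 1" using y1 y2 by (simp add: thompson_c_formula[OF yS])
  finally show ?case by (simp add: y_def)
qed

text \<open>An orbit staying in \<open>[1/2, 1)\<close> would, after its first step, double its distance to 1 forever.\<close>
lemma thompson_c_reaches_first_half:
  assumes x: "x \<in> S1"
  shows "\<exists>i. (thompson_c n ^^ i) x \<in> {0..<1/2}"
proof (rule ccontr)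
  define e where "e = (1::real) / 2 ^ (n + 1)"
  have e: "0 < e" "e \<le> 1/2" by (auto simp: e_def field_simps)
  assume "\<not> ?thesis"
  moreover have S: "(thompson_c n ^^ i) x \<in> S1" for i
  proof (induction i)
    case (Suc i)
    have "thompson_c n \<in> Bij S1" using thompson_c_in_T by (simp add: thompson_T_def thompson_T_maps_def)
    then show ?case using Suc Bij_imp_funcset by (fastforce simp del: atLeastLessThan_iff)
  qed (use x in simp)
  ultimately have ge: "1/2 \<le> (thompson_c n ^^ i) x" for i by (meson atLeastLessThan_iff not_less)
  have c: "thompson_c n z = (if z < 1 - e then 2 * z - 1 else z - e)" if "z \<in> S1" "1/2 \<le> z" for z
    using that by (simp add: thompson_c_formula e_def)
  define y where "y = thompson_c n x"
  have y: "e < 1 - y" using c[OF x] ge[of 0] x e by (auto simp: y_def split: if_splits)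
  have dist: "1 - (thompson_c n ^^ Suc i) x = 2 ^ i * (1 - y)" for i
  proof (induction i)
    case (Suc i)
    have "1 * (1 - y) \<le> 2 ^ i * (1 - y)" using y e by (intro mult_right_mono) auto
    then have "1 - y \<le> 1 - (thompson_c n ^^ Suc i) x" by (simp only: Suc mult_1)
    then have "(thompson_c n ^^ Suc i) x < 1 - e" using y by linarith
    then show ?case using Suc c[OF S ge, of "Suc i"] by simp
  qed (simp add: y_def)
  have "2 ^ (n + 1) * e < 2 ^ (n + 1) * (1 - y)" using y by (intro mult_strict_left_mono) auto
  then have "1 < 1 - (thompson_c n ^^ Suc (n + 1)) x" unfolding dist by (simp add: e_def)
  with ge[of "Suc (n + 1)"] show False by linarith
qed

text \<open>The power \<open>c_n^(n+2)\<close> fixes \<open>I_0\<close> pointwise; since it commutes with \<open>c_n\<close>, whose orbits all meet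
  \<open>I_0\<close>, it is the identity. No smaller power is, because 0 does not return earlier.\<close>
lemma ord_thompson_c: "group.ord thompson_T (thompson_c n) = n + 2"
proof -
  interpret T: group thompson_T by (rule group_thompson_T)
  let ?c = "thompson_c n"
  have c: "?c \<in> carrier thompson_T" by (rule thompson_c_in_T)
  let ?p = "?c [^]\<^bsub>thompson_T\<^esub> (n + 2)"
  have p: "?p \<in> carrier thompson_T" using c by simp
  have Bij: "f \<in> Bij S1" if "f \<in> carrier thompson_T" for f
    using that by (simp add: thompson_T_def thompson_T_maps_def)
  have one: "\<one>\<^bsub>thompson_T\<^esub> = (\<lambda>x\<in>S1. x)" by (simp add: thompson_T_def BijGroup_def)
  have half: "?p t = t" if "t \<in> {0..<1/2}" for t
  proof -
    have "?p t = (?c ^^ (n + 2)) t" using that by (intro thompson_T_pow_apply[OF c]) auto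
    also have "\<dots> = 1 - 2 ^ n / 2 ^ n * (1 - t)" by (rule thompson_c_funpow_first_half[OF that order_refl])
    finally show ?thesis by simp
  qed
  have "?p x = x" if x: "x \<in> S1" for x
  proof -
    obtain i where i: "(?c ^^ i) x \<in> {0..<1/2}" using thompson_c_reaches_first_half[OF x] by blast
    let ?q = "?c [^]\<^bsub>thompson_T\<^esub> i"
    have q: "?q \<in> carrier thompson_T" using c by simp
    have px: "?p x \<in> S1" using Bij[OF p] x Bij_imp_funcset by blast
    have "?q (?p x) = (?q \<otimes>\<^bsub>thompson_T\<^esub> ?p) x"
      by (rule thompson_T_mult_apply[OF q p x, symmetric])
    also have "?q \<otimes>\<^bsub>thompson_T\<^esub> ?p = ?p \<otimes>\<^bsub>thompson_T\<^esub> ?q"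
      using c by (simp only: T.nat_pow_mult add.commute)
    also have "(?p \<otimes>\<^bsub>thompson_T\<^esub> ?q) x = ?p (?q x)"
      by (rule thompson_T_mult_apply[OF p q x])
    also have "\<dots> = ?q x" by (rule half) (use i in \<open>simp only: thompson_T_pow_apply[OF c x]\<close>)
    finally have eq: "?q (?p x) = ?q x" .
    have "inj_on ?q S1" using Bij[OF q] by (simp only: Bij_def bij_betw_def Int_iff mem_Collect_eq)
    from inj_onD[OF this eq px x] show ?thesis .
  qed
  moreover have "?p \<in> extensional S1" using Bij[OF p] by (simp only: Bij_def Int_iff)
  ultimately have "?p = \<one>\<^bsub>thompson_T\<^esub>"
    unfolding one by (intro extensionalityI[of _ S1]) (simp_all only: restrict_extensional restrict_apply if_True)
  then have dvd: "T.ord ?c dvd n + 2" using T.pow_eq_id[OF c] by blast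
  define k where "k = T.ord ?c"
  have "?c [^]\<^bsub>thompson_T\<^esub> k = \<one>\<^bsub>thompson_T\<^esub>" unfolding k_def using c by simp
  then have k0: "(?c ^^ k) 0 = 0" using thompson_T_pow_apply[OF c, of 0 k] by (simp add: one)
  have k: "0 < k" "k \<le> n + 2" using dvd dvd_imp_le[OF dvd] by (auto simp: k_def intro: Nat.gr0I)
  have "k \<noteq> 1"
  proof
    assume "k = 1"
    then have "1 - 1 / 2 ^ (n + 1) = (0::real)" using k0 by (simp add: thompson_c_formula)
    then show False using one_less_power[of "2::real" "n + 1"] by (simp add: field_simps)
  qed
  with k have "k = (k - 2) + 2" "k - 2 \<le> n" by linarith+
  then obtain i where i: "k = i + 2" "i \<le> n" by blast
  then have "(2::real) ^ i = 2 ^ n" using thompson_c_funpow_first_half[of 0 i n] k0 by simp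
  then show ?thesis using i by (simp add: k_def)
qed

section \<open>Torsion elements\<close>

lemma (in group) conj_int_pow:
  assumes h: "h \<in> carrier G" and x: "x \<in> carrier G"
  shows "(h \<otimes> x \<otimes> inv h) [^] (i::int) = h \<otimes> x [^] i \<otimes> inv h"
proof -
  interpret conj: group_hom G G "\<lambda>x. h \<otimes> x \<otimes> inv h"
  proof (unfold_locales, rule homI)
    fix x y assume xy: "x \<in> carrier G" "y \<in> carrier G"
    have "inv h \<otimes> (h \<otimes> (y \<otimes> inv h)) = y \<otimes> inv h"
      using h xy by (simp flip: m_assoc)
    then show "h \<otimes> (x \<otimes> y) \<otimes> inv h = (h \<otimes> x \<otimes> inv h) \<otimes> (h \<otimes> y \<otimes> inv h)"
      using h xy by (simp add: m_assoc)
  qed (use h in simp)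
  show ?thesis using conj.hom_int_pow[OF x] by simp
qed

theorem corollary6p2:
  fixes g :: "real \<Rightarrow> real"
  assumes "g \<in> carrier thompson_T"
  shows "torsion_element thompson_T g \<longleftrightarrow>
    (\<exists>(i::nat) (j::int). conjugate_in thompson_T g (thompson_c i [^]\<^bsub>thompson_T\<^esub> j))"
proof
  interpret T: group thompson_T by (rule group_thompson_T)
  assume "torsion_element thompson_T g"
  then obtain r :: nat where "r > 0" "g [^]\<^bsub>thompson_T\<^esub> r = \<one>\<^bsub>thompson_T\<^esub>"
    by (auto simp: torsion_element_def)
  then have pos: "T.ord g > 0" using T.pow_eq_id[OF assms, of r] by (auto intro: Nat.gr0I)
  show "\<exists>(i::nat) (j::int). conjugate_in thompson_T g (thompson_c i [^]\<^bsub>thompson_T\<^esub> j)"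
  proof (cases "T.ord g = 1")
    case True
    then have "g = \<one>\<^bsub>thompson_T\<^esub>" using T.pow_ord_eq_1[OF assms] assms by simp
    then have "conjugate_in thompson_T g (thompson_c 0 [^]\<^bsub>thompson_T\<^esub> (0::int))"
      unfolding conjugate_in_def by (intro bexI[of _ "\<one>\<^bsub>thompson_T\<^esub>"]) simp_all
    then show ?thesis by blast
  next
    case False
    define n where "n = T.ord g - 2"
    define c where "c = thompson_c n"
    have ord_g: "T.ord g = n + 2" using False pos by (simp add: n_def)
    have m: "0 < n + 2" by simp
    have c: "c \<in> carrier thompson_T" "T.ord c = n + 2"
      by (simp_all add: c_def thompson_c_in_T ord_thompson_c)
    obtain K d j where K: "K \<in> lifted_T" "\<And>x. (K ^^ (n + 2)) x = x + 1"
      "circle_map K = g [^]\<^bsub>thompson_T\<^esub> (d::nat)" "g = circle_map K [^]\<^bsub>thompson_T\<^esub> (j::int)"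
      by (rule generator_with_unit_translation[OF assms ord_g m], rule that)
    obtain E d' j' where E: "E \<in> lifted_T" "\<And>x. (E ^^ (n + 2)) x = x + 1"
      "circle_map E = c [^]\<^bsub>thompson_T\<^esub> (d'::nat)" "c = circle_map E [^]\<^bsub>thompson_T\<^esub> (j'::int)"
      by (rule generator_with_unit_translation[OF c m], rule that)
    obtain H where H: "H \<in> lifted_T" "H \<circ> K = E \<circ> H"
      using roots_of_translation_conjugate[OF K(1,2) E(1,2)] by blast
    define h where "h = circle_map H"
    define k where "k = circle_map K"
    define e where "e = circle_map E"
    have h: "h \<in> carrier thompson_T" and k: "k \<in> carrier thompson_T" and e: "e \<in> carrier thompson_T"
      using H K E circle_map_in_T by (simp_all add: h_def k_def e_def)
    have "h \<otimes>\<^bsub>thompson_T\<^esub> k = e \<otimes>\<^bsub>thompson_T\<^esub> h"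
      using H(2) circle_map_compose[OF K(1) H(1)] circle_map_compose[OF H(1) E(1)]
      by (simp add: h_def k_def e_def)
    then have "k = inv\<^bsub>thompson_T\<^esub> h \<otimes>\<^bsub>thompson_T\<^esub> (e \<otimes>\<^bsub>thompson_T\<^esub> h)"
      using h k e by (metis T.inv_solve_left T.m_closed)
    then have "k = inv\<^bsub>thompson_T\<^esub> h \<otimes>\<^bsub>thompson_T\<^esub> e \<otimes>\<^bsub>thompson_T\<^esub> inv\<^bsub>thompson_T\<^esub> (inv\<^bsub>thompson_T\<^esub> h)"
      using h e by (simp add: T.m_assoc)
    then have "g = inv\<^bsub>thompson_T\<^esub> h \<otimes>\<^bsub>thompson_T\<^esub> (e [^]\<^bsub>thompson_T\<^esub> j) \<otimes>\<^bsub>thompson_T\<^esub> inv\<^bsub>thompson_T\<^esub> (inv\<^bsub>thompson_T\<^esub> h)"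
      using K(4) h e by (simp only: k_def[symmetric] T.conj_int_pow T.inv_closed)
    moreover have "e [^]\<^bsub>thompson_T\<^esub> j = c [^]\<^bsub>thompson_T\<^esub> (int d' * j)"
      using c(1) E(3) by (simp add: e_def T.int_pow_pow flip: int_pow_int)
    ultimately have "conjugate_in thompson_T g (thompson_c n [^]\<^bsub>thompson_T\<^esub> (int d' * j))"
      unfolding conjugate_in_def c_def using T.inv_closed[OF h] by metis
    then show ?thesis by blast
  qed
next
  interpret T: group thompson_T by (rule group_thompson_T)
  assume "\<exists>(i::nat) (j::int). conjugate_in thompson_T g (thompson_c i [^]\<^bsub>thompson_T\<^esub> j)"
  then obtain i :: nat and j :: int and h where h: "h \<in> carrier thompson_T"
    and g: "g = h \<otimes>\<^bsub>thompson_T\<^esub> (thompson_c i [^]\<^bsub>thompson_T\<^esub> j) \<otimes>\<^bsub>thompson_T\<^esub> inv\<^bsub>thompson_T\<^esub> h"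
    by (auto simp: conjugate_in_def)
  have c: "thompson_c i \<in> carrier thompson_T" by (rule thompson_c_in_T)
  have "g [^]\<^bsub>thompson_T\<^esub> int (i + 2)
    = h \<otimes>\<^bsub>thompson_T\<^esub> (thompson_c i [^]\<^bsub>thompson_T\<^esub> (j * int (i + 2))) \<otimes>\<^bsub>thompson_T\<^esub> inv\<^bsub>thompson_T\<^esub> h"
    unfolding g using h c by (simp only: T.conj_int_pow T.int_pow_closed T.int_pow_pow)
  also have "thompson_c i [^]\<^bsub>thompson_T\<^esub> (j * int (i + 2)) = \<one>\<^bsub>thompson_T\<^esub>"
    unfolding T.int_pow_eq_id[OF c] ord_thompson_c by simp
  finally have "g [^]\<^bsub>thompson_T\<^esub> (i + 2) = \<one>\<^bsub>thompson_T\<^esub>"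
    unfolding int_pow_int using h by simp
  then show "torsion_element thompson_T g"
    using assms unfolding torsion_element_def by (intro conjI exI[of _ "i + 2"]) auto
qed

end
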